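(* Let $n\ge2$, let $\delta\ge4+(n+3)\log2$, and let $\mathbf{P}\colon[q_0,\infty)\to\mathbb{R}^n$ be a rigid $n$-system with mesh $\delta$. Then there exists a unit vector $\mathbf{u}\in\mathbb{R}^n$ such that $\sup_{q\ge q_0}\|\mathbf{P}(q)-\mathbf{L}_\mathbf{u}(q)\|_\infty\le n\log(8e^4n)$.
   Context: $\Delta_n=\{x\in\mathbb{R}^n:x_1\le\cdots\le x_n\}$ and $\Phi_n\colon\mathbb{R}^n\to\Delta_n$ sorts coordinates increasingly. For a unit vector $\mathbf{u}$ and $q\ge0$, $\mathcal{C}_\mathbf{u}(e^q)=\{\mathbf{x}\in\mathbb{R}^n:\|\mathbf{x}\|\le1,|\mathbf{x}\cdot\mathbf{u}|\le e^{-q}\}$, $L_{\mathbf{u},j}(q)$ is the smallest $L\ge0$ such that $e^L\mathcal{C}_\mathbf{u}(e^q)$ contains $j$ linearly independent points of $\mathbb{Z}^n$, and $\mathbf{L}_\mathbf{u}=(L_{\mathbf{u},1},\dots,L_{\mathbf{u},n})$. A canvas with mesh $\delta$ and cardinality $s\in\{1,2,\dots\}\cup\{\infty\}$: points $\mathbf{a}^{(i)}\in\Delta_n$ and integers $k_i,\ell_i$ ($0\le i<s$) with (C1) $a^{(i)}_1<\cdots<a^{(i)}_n$ positive integer multiples of $\delta$; (C2) $1\le k_0\le\ell_0=n$, and $1\le k_i<\ell_i\le n$ for $i\ge1$; (C3) if $i+1<s$: $k_i\le\ell_{i+1}$, $a^{(i)}_{\ell_{i+1}}+\delta\le a^{(i+1)}_{\ell_{i+1}}$,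 and deleting coordinate $k_i$ of $\mathbf{a}^{(i)}$ gives the same tuple as deleting coordinate $\ell_{i+1}$ of $\mathbf{a}^{(i+1)}$. With $q_i=a^{(i)}_1+\cdots+a^{(i)}_n$ and $q_s=\infty$ if $s<\infty$, the attached rigid $n$-system with mesh $\delta$ is $\mathbf{P}\colon[q_0,\infty)\to\Delta_n$, $\mathbf{P}(q)=\Phi_n(a^{(i)}_1,\dots,\widehat{a^{(i)}_{k_i}},\dots,a^{(i)}_n,a^{(i)}_{k_i}+q-q_i)$ for $q_i\le q<q_{i+1}$ (hat = omission). *)

theory Defs
  imports "HOL-Analysis.Analysis" "HOL-Library.Extended_Nat"
begin

text \<open>
  The unit vector and the lattice live in \<open>real ^ 'n\<close>, with \<open>n = CARD('n)\<close>. The tuples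
  of a canvas and the values of an \<open>n\<close>-system, whose coordinates are ordered, are lists of
  length \<open>n\<close>. Coordinates are numbered from 1, so that \<open>coord x j\<close> and \<open>del_coord x j\<close> are
  meaningful for \<open>1 \<le> j \<le> length x\<close>. The sorting map is the library function \<open>sort\<close>.
\<close>

definition Delta :: "nat \<Rightarrow> real list set" where
  "Delta n = {x. length x = n \<and> sorted x}"

definition coord :: "real list \<Rightarrow> nat \<Rightarrow> real" where
  "coord x j = x ! (j - 1)"

definition del_coord :: "real list \<Rightarrow> nat \<Rightarrow> real list" where
  "del_coord x j = take (j - 1) x @ drop j x"

text \<open>\<open>body u q\<close> is the set written $\mathcal{C}_u(e^q)$.\<close>

definition body :: "real ^ 'n \<Rightarrow> real \<Rightarrow> (real ^ 'n) set" where
  "body u q = {x. norm x \<le> 1 \<and> \<bar>x \<bullet> u\<bar> \<le> exp (- q)}"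

definition int_lattice :: "(real ^ 'n) set" where
  "int_lattice = {x. \<forall>i. x $ i \<in> \<int>}"

text \<open>The minimum below exists for \<open>1 \<le> j \<le> CARD('n)\<close>: the dilates of the compact set
  \<open>body u q\<close> grow with \<open>L\<close>, exhaust the space, and each contains finitely many lattice points.\<close>

definition log_min :: "real ^ 'n \<Rightarrow> nat \<Rightarrow> real \<Rightarrow> real" where
  "log_min u j q =
    (LEAST L. 0 \<le> L \<and>
       (\<exists>S. S \<subseteq> (\<lambda>x. exp L *\<^sub>R x) ` body u q \<inter> int_lattice \<and>
            finite S \<and> card S = j \<and> independent S))"

definition log_minima :: "real ^ 'n \<Rightarrow> real \<Rightarrow> real list" where
  "log_minima u q = map (\<lambda>j. log_min u j q) [1..<CARD('n) + 1]"

definition canvas ::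
  "nat \<Rightarrow> real \<Rightarrow> enat \<Rightarrow> (nat \<Rightarrow> real list) \<Rightarrow> (nat \<Rightarrow> nat) \<Rightarrow> (nat \<Rightarrow> nat) \<Rightarrow> bool" where
  "canvas n \<delta> s a k l \<longleftrightarrow>
     1 \<le> s \<and>
     (\<forall>i. enat i < s \<longrightarrow>
        a i \<in> Delta n \<and>
        sorted_wrt (<) (a i) \<and>
        (\<forall>x\<in>set (a i). \<exists>m::nat. 0 < m \<and> x = real m * \<delta>)) \<and>
     1 \<le> k 0 \<and> k 0 \<le> l 0 \<and> l 0 = n \<and>
     (\<forall>i. 1 \<le> i \<and> enat i < s \<longrightarrow> 1 \<le> k i \<and> k i < l i \<and> l i \<le> n) \<and>
     (\<forall>i. enat (i + 1) < s \<longrightarrow>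
        k i \<le> l (i + 1) \<and>
        coord (a i) (l (i + 1)) + \<delta> \<le> coord (a (i + 1)) (l (i + 1)) \<and>
        del_coord (a i) (k i) = del_coord (a (i + 1)) (l (i + 1)))"

definition switch :: "(nat \<Rightarrow> real list) \<Rightarrow> nat \<Rightarrow> real" where
  "switch a i = sum_list (a i)"

text \<open>\<open>P\<close> is a function on \<open>[q0, \<infinity>)\<close>; its values to the left of \<open>q0\<close> are unconstrained.
  When \<open>i\<close> is the last index of a finite canvas, the interval of validity is \<open>[switch a i, \<infinity>)\<close>.\<close>

definition rigid_system :: "nat \<Rightarrow> real \<Rightarrow> real \<Rightarrow> (real \<Rightarrow> real list) \<Rightarrow> bool" where
  "rigid_system n \<delta> q0 P \<longleftrightarrow>
     (\<exists>s a k l. canvas n \<delta> s a k l \<and> q0 = switch a 0 \<and>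
        (\<forall>i q. enat i < s \<and> switch a i \<le> q \<and> (enat (i + 1) < s \<longrightarrow> q < switch a (i + 1)) \<longrightarrow>
           P q = sort (del_coord (a i) (k i) @ [coord (a i) (k i) + q - switch a i])))"

definition dist_inf :: "nat \<Rightarrow> real list \<Rightarrow> real list \<Rightarrow> real" where
  "dist_inf n x y = Max ((\<lambda>j. \<bar>coord x j - coord y j\<bar>) ` {1..n})"

end

theory Submission
  imports Defs
begin

text \<open>
  The vector \<open>u\<close> is the limit of unit normals to hyperplanes spanned by all but one vector of a
  basis of the integer lattice. At index \<open>i\<close> of the canvas the basis vectors \<open>X m\<close> have
  \<open>ln (norm (X m))\<close> close to the coordinates of \<open>a i\<close>, and all of them except the one
  belonging to \<open>k i\<close> are almost orthogonal and lie in the hyperplane. The exceptional vector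
  \<open>X \<kappa>\<close> is then close to the hyperplane because the determinant is \<open>1\<close>. To
  pass to \<open>i + 1\<close>, one adds to \<open>X \<kappa>\<close> an integral combination of shorter basis
  vectors so that the result has the prescribed length and is nearly orthogonal to the shorter
  vectors that stay in the hyperplane. This turns the hyperplane by an angle of order
  \<open>exp (- switch a (i + 1))\<close>, so the normals converge. The basis at index \<open>i\<close> bounds the
  minima of \<open>u\<close> from above on the \<open>i\<close>-th interval; since the minima add up to \<open>q\<close> up to
  a constant, the same points give the lower bounds.

  Basis vectors and coordinates are indexed by labels in \<open>'n\<close> and ordered by the size \<open>b m\<close> of
  the coordinate with label \<open>m\<close>, so that a step of the canvas changes a single label and no
  position has to be shifted.
\<close>

section \<open>Orthogonal projections and determinants\<close>

text \<open>A turn has size \<open>exp (- switch a (i + 1))\<close> for this reason. The new vector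
  is congruent to \<open>X \<kappa>\<close> modulo the hyperplane, hence exactly as far from it, and
  that distance is at most \<open>2 * exp (b \<kappa> - switch a i)\<close>; its own length is about
  \<open>exp c\<close>, and \<open>switch a (i + 1) = switch a i - b \<kappa> + c\<close>. The
  obstacle is that a long vector may survive arbitrarily many turns among the shorter ones, each of
  which spoils its orthogonality a little. No fixed loss per step is affordable, so every loss is
  charged either to a descent in the ordering of the labels, where a surviving label only ever moves
  down, or to a quantity that decays geometrically. Constants: one turn moves the unit normal by at
  most \<open>8 * exp (- switch a (i + 1))\<close>, all later turns together by
  \<open>16 * exp (- q)\<close>. Against vectors of norm at most \<open>2 * exp (b m)\<close> this
  gives 32; the determinant gives a further 2 for the exceptional vector, whence
  \<open>ln 34\<close>. Hadamard's inequality contributes \<open>ln 2 / 2\<close> per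
  coordinate.\<close>

definition perp :: "'a::euclidean_space set \<Rightarrow> 'a \<Rightarrow> 'a" where
  "perp S x = (SOME z. x - z \<in> span S \<and> (\<forall>w\<in>span S. z \<bullet> w = 0))"

lemma perp:
  shows diff_perp_in_span: "x - perp S x \<in> span S"
    and inner_perp_span: "w \<in> span S \<Longrightarrow> perp S x \<bullet> w = 0"
proof -
  obtain y z where "y \<in> span S" "\<And>w. w \<in> span S \<Longrightarrow> orthogonal z w" "x = y + z"
    using orthogonal_subspace_decomp_exists[of S x] by blast
  then have "\<exists>z. x - z \<in> span S \<and> (\<forall>w\<in>span S. z \<bullet> w = 0)"
    by (intro exI[of _ z]) (auto simp: orthogonal_def)
  from someI_ex[OF this, folded perp_def]
  show "x - perp S x \<in> span S" "w \<in> span S \<Longrightarrow> perp S x \<bullet> w = 0"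
    by blast+
qed

text \<open>Uniqueness of the decomposition, so the choice made in \<open>perp\<close> is
  immaterial: \<open>norm (perp S x)\<close> is the distance from \<open>x\<close> to
  \<open>span S\<close>.\<close>

lemma perp_eqI:
  assumes "x - z \<in> span S" "\<And>w. w \<in> span S \<Longrightarrow> z \<bullet> w = 0"
  shows "perp S x = z"
proof -
  have "perp S x - z = (x - z) - (x - perp S x)" by simp
  then have "perp S x - z \<in> span S"
    using assms(1) diff_perp_in_span span_diff by metis
  then have "(perp S x - z) \<bullet> (perp S x - z) = 0"
    using assms(2) inner_perp_span by (metis inner_diff_left diff_zero)
  then show ?thesis by simp
qed

lemma perp_in_span: "x \<in> span T \<Longrightarrow> S \<subseteq> span T \<Longrightarrow> perp S x \<in> span T"
  using diff_perp_in_span[of x S] span_diff[of x T "x - perp S x"] span_minimal[of S "span T"]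
  by auto

lemma perp_add: "perp S (x + y) = perp S x + perp S y"
proof (rule perp_eqI)
  have "x + y - (perp S x + perp S y) = (x - perp S x) + (y - perp S y)" by simp
  then show "x + y - (perp S x + perp S y) \<in> span S"
    by (metis diff_perp_in_span span_add)
qed (simp add: inner_perp_span inner_add_left)

lemma perp_scaleR: "perp S (c *\<^sub>R x) = c *\<^sub>R perp S x"
  by (rule perp_eqI)
     (simp_all add: inner_perp_span diff_perp_in_span span_scale flip: scaleR_diff_right)

lemma perp_span: "x \<in> span S \<Longrightarrow> perp S x = 0"
  by (rule perp_eqI) auto

lemma perp_add_span: "w \<in> span S \<Longrightarrow> perp S (x + w) = perp S x"
  by (simp add: perp_add perp_span)

lemma perp_diff_span: "w \<in> span S \<Longrightarrow> perp S (x - w) = perp S x"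
  using perp_add_span[of "-w" S x] by (simp add: span_neg)

lemma inner_perp_self: "perp S x \<bullet> x = perp S x \<bullet> perp S x"
  using inner_perp_span[OF diff_perp_in_span, of S x x] by (simp add: inner_diff_right)

lemma norm_perp_le: "norm (perp S x) \<le> norm x"
proof -
  have "(norm (perp S x))\<^sup>2 \<le> norm (perp S x) * norm x"
    using norm_cauchy_schwarz[of "perp S x" x]
    by (simp add: inner_perp_self power2_norm_eq_inner)
  then show ?thesis
    by (cases "norm (perp S x) = 0") (auto simp: power2_eq_square)
qed

lemma norm_perp_le_diff: "w \<in> span S \<Longrightarrow> norm (perp S x) \<le> norm (x - w)"
  using norm_perp_le[of S "x - w"] by (simp add: perp_diff_span)

lemma norm_perp_antimono:
  assumes "S \<subseteq> span T"
  shows "norm (perp T x) \<le> norm (perp S x)"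
proof -
  have "x - perp S x \<in> span T"
    using assms diff_perp_in_span[of x S] span_minimal[of S "span T"] by auto
  from norm_perp_le_diff[OF this, of x] show ?thesis by simp
qed

lemma perp_cong: "span S = span T \<Longrightarrow> perp S x = perp T x"
  by (simp add: perp_def)

text \<open>The part of \<open>x\<close> in \<open>span S\<close> is invisible to a vector normal to
  \<open>S\<close>. With \<open>v\<close> a unit normal of a hyperplane, this passes from distances
  to inner products.\<close>

lemma inner_le_norm_perp:
  assumes "\<And>w. w \<in> S \<Longrightarrow> v \<bullet> w = 0"
  shows "\<bar>v \<bullet> x\<bar> \<le> norm v * norm (perp S x)"
proof -
  have "v \<bullet> w = 0" if "w \<in> span S" for w
    using that assms by (induction rule: span_induct_alt) (auto simp: inner_add_right)
  then have "v \<bullet> x = v \<bullet> perp S x"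
    using diff_perp_in_span[of x S] by (metis inner_diff_right right_minus_eq)
  then show ?thesis by (simp add: Cauchy_Schwarz_ineq2)
qed

text \<open>One Gram-Schmidt step. If \<open>y\<close> already lies in \<open>span S\<close>, the
  quotient is a division by zero with value 0 and the formula stays correct.\<close>

lemma perp_insert:
  "perp (insert y S) x =
     perp S x - ((perp S x \<bullet> perp S y) / (perp S y \<bullet> perp S y)) *\<^sub>R perp S y"
    (is "_ = ?p - ?c *\<^sub>R ?q")
proof (rule perp_eqI)
  have "?q \<in> span (insert y S)"
    by (rule perp_in_span) (auto simp: span_base)
  moreover have "x - ?p \<in> span (insert y S)"
    using diff_perp_in_span span_mono[of S "insert y S"] by blast
  ultimately have "x - ?p + ?c *\<^sub>R ?q \<in> span (insert y S)"
    by (intro span_add span_scale)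
  then show "x - (?p - ?c *\<^sub>R ?q) \<in> span (insert y S)"
    by (simp add: algebra_simps)
  fix w assume "w \<in> span (insert y S)"
  then obtain k where "w - k *\<^sub>R y \<in> span S"
    by (auto simp: span_breakdown_eq)
  then have "?p \<bullet> w = k * (?p \<bullet> y)" "?q \<bullet> w = k * (?q \<bullet> y)"
    using inner_perp_span[of "w - k *\<^sub>R y" S] by (simp_all add: inner_diff_right)
  moreover have "?p \<bullet> y = ?p \<bullet> ?q"
    using inner_perp_span[OF diff_perp_in_span, of S x y] by (simp add: inner_diff_right)
  ultimately show "(?p - ?c *\<^sub>R ?q) \<bullet> w = 0"
    by (simp add: inner_diff_left inner_perp_self)
qed

text \<open>Both sides are the area spanned by \<open>x\<close> and \<open>y\<close> modulo \<open>span S\<close>.\<close>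

lemma perp_insert_swap:
  "norm (perp (insert y S) x) * norm (perp S y) = norm (perp (insert x S) y) * norm (perp S x)"
proof -
  \<comment> \<open>The right-hand side is the Gram determinant of the two projections, which is
    symmetric in \<open>x\<close> and \<open>y\<close>.\<close>
  have sq: "(norm (perp (insert y S) x) * norm (perp S y))\<^sup>2 =
      (perp S x \<bullet> perp S x) * (perp S y \<bullet> perp S y) - (perp S x \<bullet> perp S y)\<^sup>2" for x y
  proof (cases "perp S y = 0")
    case False
    then show ?thesis
      unfolding perp_insert power_mult_distrib power2_norm_eq_inner
      by (simp add: inner_diff_left inner_diff_right inner_commute[of "perp S y" "perp S x"]
          field_simps power2_eq_square)
  qed simp
  have "(norm (perp (insert y S) x) * norm (perp S y))\<^sup>2 =
        (norm (perp (insert x S) y) * norm (perp S x))\<^sup>2"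
    unfolding sq by (simp add: inner_commute mult.commute)
  then show ?thesis
    by (simp add: power2_eq_iff_nonneg)
qed

text \<open>The price of replacing \<open>z\<close> by \<open>y\<close> among the generators. The
  projection \<open>w\<close> of \<open>x\<close> to the new span is \<open>s *\<^sub>R y\<close>
  modulo \<open>span G\<close>, with \<open>s\<close> bounded through \<open>norm x\<close>, so
  \<open>w\<close> is nearly in the old span. The quotient of the two norms of \<open>y\<close> is
  the sine of its angle with the old span, measured modulo \<open>span G\<close>.\<close>

lemma norm_perp_insert_ge:
  assumes G: "perp G y \<noteq> 0"
  shows "norm (perp (insert z G) x) - norm x * norm (perp (insert z G) y) / norm (perp G y)
    \<le> norm (perp (insert y G) x)"
proof -
  let ?E = "insert z G"
  define w where "w = x - perp (insert y G) x"
  have "w \<in> span (insert y G)"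
    unfolding w_def by (rule diff_perp_in_span)
  then obtain s where s: "w - s *\<^sub>R y \<in> span G"
    by (auto simp: span_breakdown_eq)
  have "perp (insert y G) x \<bullet> w = 0"
    by (rule inner_perp_span) fact
  then have "(norm x)\<^sup>2 = (norm (perp (insert y G) x))\<^sup>2 + (norm w)\<^sup>2"
    by (simp add: w_def power2_norm_eq_inner inner_diff_left inner_diff_right inner_commute)
  then have wx: "norm w \<le> norm x"
    by (simp add: power2_le_imp_le)
  have "perp G w = s *\<^sub>R perp G y"
    using perp_add_span[OF s, of "s *\<^sub>R y"] by (simp add: perp_scaleR)
  then have "\<bar>s\<bar> * norm (perp G y) \<le> norm x"
    using norm_perp_le[of G w] wx by simp
  then have s_le: "\<bar>s\<bar> \<le> norm x / norm (perp G y)"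
    using G by (simp add: field_simps)
  have "w - s *\<^sub>R y \<in> span ?E"
    using s span_mono[of G ?E] by auto
  from perp_add_span[OF this, of "s *\<^sub>R y"] have "perp ?E w = s *\<^sub>R perp ?E y"
    by (simp add: perp_scaleR)
  then have "perp ?E (x - w) = perp ?E x - s *\<^sub>R perp ?E y"
    using perp_add[of ?E "x - w" w] by simp
  then have "norm (perp ?E x) - \<bar>s\<bar> * norm (perp ?E y) \<le> norm (perp ?E (x - w))"
    using norm_triangle_ineq2[of "perp ?E x" "s *\<^sub>R perp ?E y"] by simp
  also have "\<dots> \<le> norm (perp (insert y G) x)"
    using norm_perp_le[of ?E "x - w"] by (simp add: w_def)
  finally show ?thesis
    using mult_right_mono[OF s_le norm_ge_zero[of "perp ?E y"]] by simp
qed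

text \<open>Adjoin the \<open>v m\<close> in increasing order of \<open>f\<close>. By
  \<open>perp_insert_swap\<close>, the factor that \<open>y\<close> loses when \<open>v m\<close> is
  adjoined equals the factor that \<open>v m\<close> loses when \<open>y\<close> is adjoined, and
  the hypothesis bounds the latter.\<close>

lemma norm_perp_chain:
  fixes f :: "'i \<Rightarrow> real"
  assumes "finite T" "inj_on f T" "0 \<le> \<theta>" "\<theta> \<le> 1"
    and "\<And>m. m \<in> T \<Longrightarrow>
      \<theta> * norm (v m) \<le> norm (perp (insert y (S \<union> v ` {m'\<in>T. f m' < f m})) (v m))"
  shows "\<theta> ^ card T * norm (perp S y) \<le> norm (perp (S \<union> v ` T) y)"
  using assms(1,2,5)
proof (induction T rule: finite_ranking_induct[where f = f])
  case (insert x T)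
  show ?case
  proof (cases "x \<in> T")
    case True
    then show ?thesis using insert by (simp add: insert_absorb)
  next
    case False
    let ?H = "S \<union> v ` T"
    have lt: "f y < f x" if "y \<in> T" for y
      using insert(2)[OF that] insert.prems(1) False that
      by (metis inj_onD insertCI order_le_imp_less_or_eq)
    then have eq: "{m' \<in> insert x T. f m' < f x} = T" by auto
    have eq': "{m' \<in> insert x T. f m' < f m} = {m' \<in> T. f m' < f m}" if "m \<in> T" for m
      using lt[OF that] by auto
    have IH: "\<theta> ^ card T * norm (perp S y) \<le> norm (perp ?H y)"
    proof (rule insert.IH)
      show "inj_on f T" using insert.prems(1) by (simp add: inj_on_insert)
      show "\<theta> * norm (v m) \<le> norm (perp (insert y (S \<union> v ` {m'\<in>T. f m' < f m})) (v m))"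
        if "m \<in> T" for m
        using insert.prems(2)[of m] that unfolding eq'[OF that] by simp
    qed
    have x: "\<theta> * norm (v x) \<le> norm (perp (insert y ?H) (v x))"
      using insert.prems(2)[of x] unfolding eq by simp
    have "norm (perp (insert (v x) ?H) y) \<ge> \<theta> * norm (perp ?H y)"
    proof (cases "perp ?H (v x) = 0")
      \<comment> \<open>The exchange identity degenerates here, but adjoining \<open>v x\<close>
        does not change the span.\<close>
      case True
      have "v x \<in> span ?H"
        using diff_perp_in_span[of "v x" ?H] True by simp
      then have "perp (insert (v x) ?H) y = perp ?H y"
        by (intro perp_cong span_redundant)
      then show ?thesis
        using assms(4) by (simp add: mult_left_le_one_le assms(3))
    next
      case False
      have "\<theta> * norm (perp ?H (v x)) \<le> norm (perp (insert y ?H) (v x))"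
        using x mult_left_mono[OF norm_perp_le assms(3)] by (rule order_trans[rotated])
      then have "\<theta> * norm (perp ?H (v x)) * norm (perp ?H y)
          \<le> norm (perp (insert y ?H) (v x)) * norm (perp ?H y)"
        by (rule mult_right_mono) simp
      also have "\<dots> = norm (perp (insert (v x) ?H) y) * norm (perp ?H (v x))"
        by (rule perp_insert_swap)
      finally show ?thesis
        using False by (simp add: mult.assoc mult.commute[of _ "norm (perp ?H (v x))"])
    qed
    then have "\<theta> * (\<theta> ^ card T * norm (perp S y)) \<le> norm (perp (insert (v x) ?H) y)"
      using mult_left_mono[OF IH assms(3)] by linarith
    then show ?thesis
      using False insert(1) by (simp add: mult.assoc)
  qed
qed simp

section \<open>Determinants as products of orthogonal components\<close>

text \<open>Gram-Schmidt does not change the determinant and ends with orthogonal rows. The order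
  \<open>f\<close> is left free because the exceptional label has to come last in one application
  and first in another.\<close>

lemma det_eq_prod_perp:
  fixes A :: "'n::finite \<Rightarrow> real ^ 'n" and f :: "'n \<Rightarrow> real"
  assumes "inj f"
  shows "\<bar>det (\<chi> i. A i)\<bar> = (\<Prod>i\<in>UNIV. norm (perp (A ` {j. f j < f i}) (A i)))"
proof -
  define P where "P i = perp (A ` {j. f j < f i}) (A i)" for i
  \<comment> \<open>Rows are replaced from the largest \<open>f\<close> downwards, so that the rows
    preceding \<open>x\<close> are still the original ones when \<open>x\<close> is treated.\<close>
  have replace: "det (\<chi> i. if i \<in> T then P i else A i) = det (\<chi> i. A i)" if "finite T" for T
    using that
  proof (induction T rule: finite_ranking_induct[where f = "\<lambda>i. - f i"])
    case (insert x T)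
    show ?case
    proof (cases "x \<in> T")
      case False
      let ?B = "(\<chi> i. if i \<in> T then P i else A i) :: real^'n^'n"
      have "A j \<in> {row j ?B |j. j \<noteq> x}" if "f j < f x" for j
        using that insert(2)[of j] by (auto simp: row_def vec_nth_inverse intro!: exI[of _ j])
      then have "A ` {j. f j < f x} \<subseteq> {row j ?B |j. j \<noteq> x}" by auto
      moreover have "P x - A x \<in> span (A ` {j. f j < f x})"
        using span_neg[OF diff_perp_in_span[of "A x" "A ` {j. f j < f x}"]] by (simp add: P_def)
      ultimately have "P x - A x \<in> vec.span {row j ?B |j. j \<noteq> x}"
        unfolding span_vec_eq by (meson span_mono subsetD)
      from det_row_span[OF this] have
        "det (\<chi> k. if k = x then row x ?B + (P x - A x) else row k ?B) = det ?B" .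
      moreover have "(\<chi> k. if k = x then row x ?B + (P x - A x) else row k ?B) =
          (\<chi> i. if i \<in> insert x T then P i else A i)"
        using False by (simp add: vec_eq_iff row_def)
      ultimately show ?thesis using insert.IH by simp
    qed (use insert in \<open>simp add: insert_absorb\<close>)
  qed simp
  let ?M = "(\<chi> i. P i) :: real^'n^'n"
  have detM: "det ?M = det (\<chi> i. A i)"
    using replace[of UNIV] by simp
  have orth: "P i \<bullet> P j = 0" if "f j < f i" for i j
  proof -
    have "P j \<in> span (A ` {m. f m < f i})"
      unfolding P_def using that by (intro perp_in_span) (auto intro!: span_base)
    then show ?thesis
      unfolding P_def[of i] by (rule inner_perp_span)
  qed
  have entry: "(?M ** transpose ?M) $ i $ j = P i \<bullet> P j" for i j
    by (simp add: matrix_matrix_mult_def transpose_def inner_vec_def)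
  \<comment> \<open>The Gram matrix of the orthogonalised rows is diagonal.\<close>
  have "(det ?M)\<^sup>2 = det (?M ** transpose ?M)"
    by (simp add: det_mul power2_eq_square)
  also have "\<dots> = (\<Prod>i\<in>UNIV. (?M ** transpose ?M) $ i $ i)"
  proof (rule det_diagonal)
    fix i j :: 'n assume "i \<noteq> j"
    then have "f i < f j \<or> f j < f i"
      using assms by (metis injD linorder_neqE_linordered_idom)
    then show "(?M ** transpose ?M) $ i $ j = 0"
      using orth[of i j] orth[of j i] by (auto simp: entry inner_commute)
  qed
  also have "\<dots> = (\<Prod>i\<in>UNIV. norm (P i))\<^sup>2"
    by (simp add: entry prod_power_distrib power2_norm_eq_inner)
  finally have "\<bar>det ?M\<bar> = (\<Prod>i\<in>UNIV. norm (P i))"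
    by (smt (verit) power2_eq_iff prod_nonneg norm_ge_zero)
  then show ?thesis
    unfolding detM unfolding P_def .
qed

lemma hadamard_inequality:
  fixes A :: "'n::finite \<Rightarrow> real ^ 'n"
  shows "\<bar>det (\<chi> i. A i)\<bar> \<le> (\<Prod>i\<in>UNIV. norm (A i))"
proof -
  obtain h :: "'n \<Rightarrow> nat" where "bij_betw h UNIV {0..<CARD('n)}"
    using ex_bij_betw_finite_nat[of "UNIV :: 'n set"] by auto
  then have "inj (\<lambda>i. real (h i))"
    by (auto simp: inj_on_def bij_betw_def)
  from det_eq_prod_perp[OF this, of A] show ?thesis
    by (auto intro!: prod_mono norm_perp_le)
qed

text \<open>The map fixes the orthogonal complement of \<open>u\<close> and multiplies
  \<open>u\<close> by \<open>t\<close>. An orthogonal map taking a coordinate axis to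
  \<open>u\<close> conjugates it to a diagonal matrix.\<close>

lemma det_stretch:
  fixes u :: "real ^ 'n::finite"
  assumes "norm u = 1"
  shows "det (matrix (\<lambda>x. x + ((t - 1) * (x \<bullet> u)) *\<^sub>R u)) = t"
proof -
  define F :: "real^'n \<Rightarrow> real^'n" where "F x = x + ((t - 1) * (x \<bullet> u)) *\<^sub>R u" for x
  obtain k :: 'n where True by simp
  define D :: "real^'n \<Rightarrow> real^'n" where "D x = x + ((t - 1) * (x $ k)) *\<^sub>R axis k 1" for x
  obtain g :: "real^'n \<Rightarrow> real^'n" where g: "orthogonal_transformation g" "g (axis k 1) = u"
    using orthogonal_transformation_exists[of "axis k 1 :: real^'n" u] assms by auto
  have lin: "linear F" "linear D" "linear g"
    using g by (auto simp: F_def D_def orthogonal_transformation_linear algebra_simps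
        inner_add_left intro!: linearI)
  have "g x \<bullet> u = x $ k" for x
    using g(1) unfolding orthogonal_transformation_def by (metis g(2) inner_axis inner_real_def mult.right_neutral)
  then have "F \<circ> g = g \<circ> D"
    using g(2) lin(3) by (auto simp: F_def D_def fun_eq_iff linear_add linear_scale)
  then have "det (matrix F) * det (matrix g) = det (matrix g) * det (matrix D)"
    using lin by (metis matrix_compose det_mul)
  moreover have "det (matrix g) \<noteq> 0"
    using orthogonal_transformation_det[OF g(1)] by auto
  moreover have "det (matrix D) = (\<Prod>i\<in>UNIV. matrix D $ i $ i)"
    by (rule det_diagonal) (auto simp: matrix_def D_def axis_def)
  moreover have "\<dots> = (\<Prod>i\<in>UNIV. if i = k then t else 1)"
    by (rule prod.cong) (auto simp: matrix_def D_def axis_def)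
  ultimately have "det (matrix F) = t"
    by simp
  then show ?thesis unfolding F_def .
qed

lemma integer_det:
  fixes Y :: "'n::finite \<Rightarrow> real ^ 'n"
  assumes "\<And>m. Y m \<in> int_lattice"
  shows "det (\<chi> m. Y m) \<in> \<int>"
  using assms unfolding det_def int_lattice_def
  by (intro Ints_sum Ints_mult Ints_prod Ints_of_int) auto

text \<open>The easy half of Minkowski's second theorem: stretch by \<open>exp q\<close> along \<open>u\<close> and apply
  Hadamard's inequality.\<close>

lemma minima_sum_ge:
  fixes u :: "real ^ 'n::finite" and Y :: "'n \<Rightarrow> real ^ 'n"
  assumes u: "norm u = 1" and Y: "\<And>m. Y m \<in> int_lattice" "det (\<chi> m. Y m) \<noteq> 0"
    and L: "\<And>m. norm (Y m) \<le> exp (L m)" "\<And>m. \<bar>Y m \<bullet> u\<bar> \<le> exp (L m - q)"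
  shows "q - real CARD('n) * (ln 2 / 2) \<le> (\<Sum>m\<in>UNIV. L m)"
proof -
  define F :: "real^'n \<Rightarrow> real^'n" where "F x = x + ((exp q - 1) * (x \<bullet> u)) *\<^sub>R u" for x
  have linF: "linear F"
    by (auto simp: F_def algebra_simps inner_add_left intro!: linearI)
  have "(\<chi> m. F (Y m)) = (\<chi> m. Y m) ** transpose (matrix F)"
  proof -
    have "F (Y m) = matrix F *v Y m" for m
      by (simp add: linF)
    then show ?thesis
      by (simp add: vec_eq_iff matrix_matrix_mult_def transpose_def matrix_vector_mult_def
          mult.commute)
  qed
  then have detF: "det (\<chi> m. F (Y m)) = det (\<chi> m. Y m) * exp q"
    using det_stretch[OF u, of "exp q", folded F_def] by (simp add: det_mul)
  have "1 \<le> \<bar>det (\<chi> m. Y m)\<bar>"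
    using Ints_nonzero_abs_ge1[OF integer_det[of Y]] Y by auto
  then have "exp q \<le> \<bar>det (\<chi> m. F (Y m))\<bar>"
    by (simp add: detF abs_mult)
  also have "\<dots> \<le> (\<Prod>m\<in>UNIV. norm (F (Y m)))"
    by (rule hadamard_inequality)
  also have "\<dots> \<le> (\<Prod>m\<in>UNIV. exp (L m + ln 2 / 2))"
  proof (rule prod_mono, safe)
    fix m
    let ?y = "Y m" and ?w = "Y m \<bullet> u"
    have uu: "u \<bullet> u = 1" using u by (simp add: norm_eq_1)
    have "(norm (F ?y))\<^sup>2 = (norm ?y)\<^sup>2 + ((exp q)\<^sup>2 - 1) * ?w\<^sup>2"
      unfolding F_def power2_norm_eq_inner
      by (simp add: inner_add_left inner_add_right uu inner_commute[of u "Y m"]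
          algebra_simps power2_eq_square)
    also have "\<dots> \<le> (norm ?y)\<^sup>2 + (exp q * \<bar>?w\<bar>)\<^sup>2"
      by (simp add: power_mult_distrib algebra_simps)
    also have "\<dots> \<le> (exp (L m))\<^sup>2 + (exp (L m))\<^sup>2"
    proof (intro add_mono power_mono L(1))
      have "exp q * \<bar>?w\<bar> \<le> exp q * exp (L m - q)"
        by (rule mult_left_mono[OF L(2)]) simp
      then show "exp q * \<bar>?w\<bar> \<le> exp (L m)" by (simp flip: exp_add)
    qed auto
    \<comment> \<open>Each of the two components is at most \<open>exp (L m)\<close>, so every row
      costs a factor \<open>sqrt 2\<close>.\<close>
    also have "\<dots> = (exp (L m + ln 2 / 2))\<^sup>2"
      by (simp add: exp_add power_mult_distrib flip: exp_of_nat_mult)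
    finally show "norm (F ?y) \<le> exp (L m + ln 2 / 2)"
      by (rule power2_le_imp_le) simp
  qed simp
  also have "\<dots> = exp (\<Sum>m\<in>UNIV. L m + ln 2 / 2)"
    by (simp add: exp_sum)
  finally show ?thesis
    by (simp add: sum.distrib)
qed

lemma perp_perp: "perp S (perp S x) = perp S x"
  by (rule perp_eqI) (auto simp: inner_perp_span span_zero)

text \<open>Coefficients are attached to labels rather than to vectors, so \<open>X\<close> need not
  be injective.\<close>

lemma span_image_sum:
  assumes "finite J" "x \<in> span (X ` J)"
  obtains t where "x = (\<Sum>m\<in>J. t m *\<^sub>R X m)"
proof -
  have "\<exists>t. x = (\<Sum>m\<in>J. t m *\<^sub>R X m)"
    using assms
  proof (induction J arbitrary: x rule: finite_induct)
    case (insert i J)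
    then obtain k where "x - k *\<^sub>R X i \<in> span (X ` J)"
      by (auto simp: span_breakdown_eq)
    from insert.IH[OF this] obtain t where t: "x - k *\<^sub>R X i = (\<Sum>m\<in>J. t m *\<^sub>R X m)" ..
    have "(\<Sum>m\<in>J. (t(i := k)) m *\<^sub>R X m) = (\<Sum>m\<in>J. t m *\<^sub>R X m)"
      using insert.hyps(2) by (intro sum.cong) auto
    then have "x = (\<Sum>m\<in>insert i J. (t(i := k)) m *\<^sub>R X m)"
      using insert.hyps t by (simp add: algebra_simps)
    then show ?case by (intro exI[of _ "t(i := k)"])
  qed simp
  then show thesis using that by blast
qed

text \<open>Round down the coefficients of \<open>v\<close>; each fractional part costs at most one
  vector length.\<close>

lemma lattice_point_near:
  fixes X :: "'i \<Rightarrow> 'a::euclidean_space"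
  assumes "finite J" "v \<in> span (X ` J)"
  obtains c :: "'i \<Rightarrow> int"
    where "norm (x0 + (\<Sum>m\<in>J. of_int (c m) *\<^sub>R X m) - v) \<le> norm x0 + (\<Sum>m\<in>J. norm (X m))"
proof -
  obtain t where t: "v = (\<Sum>m\<in>J. t m *\<^sub>R X m)"
    using span_image_sum[OF assms] .
  have "x0 + (\<Sum>m\<in>J. of_int \<lfloor>t m\<rfloor> *\<^sub>R X m) - v = x0 - (\<Sum>m\<in>J. frac (t m) *\<^sub>R X m)"
    by (simp add: t frac_def scaleR_diff_left sum_subtractf)
  also have "norm \<dots> \<le> norm x0 + norm (\<Sum>m\<in>J. frac (t m) *\<^sub>R X m)"
    by (rule norm_triangle_ineq4)
  also have "\<dots> \<le> norm x0 + (\<Sum>m\<in>J. norm (X m))"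
    by (intro add_left_mono sum_norm_le)
       (auto simp: frac_ge_0 intro!: mult_left_le_one_le less_imp_le[OF frac_lt_1])
  finally show thesis by (rule that)
qed

lemma det_update_add_span:
  fixes X :: "'n::finite \<Rightarrow> real ^ 'n"
  assumes "w \<in> span (X ` (- {k}))"
  shows "det (\<chi> m. (X(k := X k + w)) m) = det (\<chi> m. X m)"
proof -
  let ?A = "(\<chi> m. X m) :: real^'n^'n"
  have "X ` (- {k}) = {row j ?A |j. j \<noteq> k}"
    by (auto simp: row_def vec_nth_inverse)
  then have "w \<in> vec.span {row j ?A |j. j \<noteq> k}"
    using assms by (simp add: span_vec_eq)
  from det_row_span[OF this] show ?thesis
    by (simp add: row_def vec_nth_inverse fun_upd_def if_distrib cong: if_cong)
qed

section \<open>Almost orthogonal lattice bases\<close>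

text \<open>The cut is at a real height and not at a label, so that it can also be made at the new
  coordinate \<open>c\<close> and above all coordinates.\<close>

definition lower :: "('n \<Rightarrow> real ^ 'n) \<Rightarrow> ('n \<Rightarrow> real) \<Rightarrow> 'n \<Rightarrow> real \<Rightarrow> (real ^ 'n) set" where
  "lower X b \<kappa> t = X ` {m. m \<noteq> \<kappa> \<and> b m < t}"

text \<open>Each position below the top may lose a further \<open>1 / (2 n\<^sup>2)\<close> of orthogonality, which pays
  for the loss when a vector moves down one position. All thresholds stay above \<open>1 - 1 / (2 n)\<close>,
  so their product is at least \<open>1 / 2\<close>.\<close>

definition threshold :: "('n::finite \<Rightarrow> real) \<Rightarrow> 'n \<Rightarrow> real" where
  "threshold b j =
     1 - (real CARD('n) - real (card {m. b m < b j})) / (2 * (real CARD('n))\<^sup>2)"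

text \<open>While only vectors shorter than \<open>X j\<close> are replaced, the span of the shorter vectors in the
  hyperplane turns again and again. The reserve is a potential that shrinks geometrically along
  these steps and dominates the angle of each of them, so the total loss stays bounded.\<close>

definition reserve ::
  "real \<Rightarrow> ('n \<Rightarrow> real ^ 'n) \<Rightarrow> ('n \<Rightarrow> real) \<Rightarrow> 'n \<Rightarrow> 'n \<Rightarrow> real" where
  "reserve \<delta> X b \<kappa> j =
     (if b \<kappa> < b j
      then 4 * exp (- \<delta>) * (norm (perp (lower X b \<kappa> (b j)) (X \<kappa>)) / exp (b \<kappa>))
      else 8 * exp (- \<delta>))"

text \<open>Integrality and determinant 1 up to sign say that \<open>X\<close> is a basis of the
  integer lattice. The vector \<open>X \<kappa>\<close> is bounded only from above, since the
  starting basis has a unit vector there.\<close>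

definition admissible ::
  "real \<Rightarrow> ('n::finite \<Rightarrow> real ^ 'n) \<Rightarrow> ('n \<Rightarrow> real) \<Rightarrow> 'n \<Rightarrow> bool" where
  "admissible \<delta> X b \<kappa> \<longleftrightarrow>
     inj b \<and> (\<forall>m. X m \<in> int_lattice) \<and> \<bar>det (\<chi> m. X m)\<bar> = 1 \<and>
     (\<forall>m. norm (X m) \<le> 2 * exp (b m)) \<and>
     (\<forall>m. m \<noteq> \<kappa> \<longrightarrow> exp (b m) \<le> norm (X m)) \<and>
     (\<forall>j. j \<noteq> \<kappa> \<longrightarrow>
        (threshold b j + reserve \<delta> X b \<kappa> j) * norm (X j)
          \<le> norm (perp (lower X b \<kappa> (b j)) (X j)))"

lemma threshold_bounds:
  fixes b :: "'n::finite \<Rightarrow> real"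
  defines "n \<equiv> real CARD('n)"
  shows "1 - 1 / (2 * n) \<le> threshold b j"
    and "threshold b j \<le> 1 - 1 / (2 * n\<^sup>2)"
proof -
  have n: "n > 0" by (simp add: n_def)
  have "{m. b m < b j} \<subset> UNIV" by auto
  then have "card {m. b m < b j} < CARD('n)"
    by (intro psubset_card_mono) auto
  then have "real (card {m. b m < b j}) + 1 \<le> n"
    unfolding n_def by linarith
  then show "threshold b j \<le> 1 - 1 / (2 * n\<^sup>2)"
    using n by (auto simp: threshold_def n_def[symmetric] divide_right_mono)
  have "(n - real (card {m. b m < b j})) / (2 * n\<^sup>2) \<le> n / (2 * n\<^sup>2)"
    by (rule divide_right_mono) auto
  then show "1 - 1 / (2 * n) \<le> threshold b j"
    using n by (simp add: threshold_def n_def[symmetric] power2_eq_square)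
qed

lemma reserve_nonneg: "0 \<le> reserve \<delta> X b \<kappa> j"
  by (simp add: reserve_def)

text \<open>The quotient in \<open>reserve\<close> is at most 2, so the constant value taken by
  labels below \<open>\<kappa>\<close> is the largest possible one.\<close>

lemma reserve_le:
  assumes "norm (X \<kappa>) \<le> 2 * exp (b \<kappa>)"
  shows "reserve \<delta> X b \<kappa> j \<le> 8 * exp (- \<delta>)"
proof -
  have "norm (perp (lower X b \<kappa> (b j)) (X \<kappa>)) / exp (b \<kappa>) \<le> 2"
    using norm_perp_le[of "lower X b \<kappa> (b j)" "X \<kappa>"] assms by (simp add: divide_le_eq)
  from mult_left_mono[OF this, of "4 * exp (- \<delta>)"] show ?thesis
    by (simp add: reserve_def)
qed

text \<open>Bernoulli's inequality; this is why all thresholds stay above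
  \<open>1 - 1 / (2 * n)\<close>.\<close>

lemma half_le_power: "1 / 2 \<le> (1 - 1 / (2 * real n)) ^ n"
proof (cases "n = 0")
  case False
  have "1 + real n * (- (1 / (2 * real n))) \<le> (1 + (- (1 / (2 * real n)))) ^ n"
    by (rule Bernoulli_inequality) (use False in \<open>simp add: field_simps\<close>)
  then show ?thesis using False by simp
qed simp

lemma admissible_perp_ge:
  fixes X :: "'n::finite \<Rightarrow> real ^ 'n"
  assumes "admissible \<delta> X b \<kappa>" "j \<noteq> \<kappa>"
  shows "(1 - 1 / (2 * real CARD('n))) * norm (X j) \<le> norm (perp (lower X b \<kappa> (b j)) (X j))"
proof -
  have "(1 - 1 / (2 * real CARD('n))) * norm (X j)
      \<le> (threshold b j + reserve \<delta> X b \<kappa> j) * norm (X j)"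
    using threshold_bounds(1)[of b j] reserve_nonneg[of \<delta> X b \<kappa> j]
    by (intro mult_right_mono) auto
  also have "\<dots> \<le> norm (perp (lower X b \<kappa> (b j)) (X j))"
    using assms by (auto simp: admissible_def)
  finally show ?thesis .
qed

text \<open>With \<open>\<kappa>\<close> put last, the determinant 1 is the distance of
  \<open>X \<kappa>\<close> to the hyperplane times the remaining orthogonal parts, whose product is
  at least half the product of the \<open>exp (b m)\<close>.\<close>

lemma admissible_covolume:
  fixes X :: "'n::finite \<Rightarrow> real ^ 'n"
  assumes adm: "admissible \<delta> X b \<kappa>"
  shows "norm (perp (X ` (- {\<kappa>})) (X \<kappa>)) \<le> 2 * exp (b \<kappa> - (\<Sum>m\<in>UNIV. b m))"
proof -
  let ?\<theta> = "1 - 1 / (2 * real CARD('n))" and ?r = "norm (perp (X ` (- {\<kappa>})) (X \<kappa>))"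
  \<comment> \<open>Any value above all coordinates moves \<open>\<kappa>\<close> to the end of the
    order.\<close>
  define f where "f m = (if m = \<kappa> then Max (range b) + 1 else b m)" for m
  have lt: "b m < Max (range b) + 1" for m
    by (intro le_less_trans[OF Max_ge less_add_one]) auto
  have "inj b" using adm by (simp add: admissible_def)
  then have inj: "inj f"
    using lt unfolding f_def inj_on_def by (metis less_irrefl)
  have "{j. f j < f \<kappa>} = - {\<kappa>}"
    using lt by (auto simp: f_def)
  moreover have "X ` {j. f j < f i} = lower X b \<kappa> (b i)" if "i \<noteq> \<kappa>" for i
  proof -
    have "\<not> Max (range b) + 1 < b i" using lt[of i] by linarith
    then have "{j. f j < f i} = {m. m \<noteq> \<kappa> \<and> b m < b i}"
      using that by (auto simp: f_def)
    then show ?thesis by (simp add: lower_def)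
  qed
  ultimately have "(\<Prod>i\<in>UNIV. norm (perp (X ` {j. f j < f i}) (X i))) =
      ?r * (\<Prod>i\<in>UNIV - {\<kappa>}. norm (perp (lower X b \<kappa> (b i)) (X i)))"
    by (subst prod.remove[of _ \<kappa>]) auto
  then have one: "1 = ?r * (\<Prod>i\<in>UNIV - {\<kappa>}. norm (perp (lower X b \<kappa> (b i)) (X i)))"
    using det_eq_prod_perp[OF inj, of X] adm by (simp add: admissible_def)
  have "1 \<le> real CARD('n)" by (simp add: Suc_leI)
  then have "1 \<le> 2 * real CARD('n)" by linarith
  then have "0 \<le> ?\<theta>" by (simp add: divide_le_eq)
  then have \<theta>: "0 \<le> ?\<theta>" "?\<theta> \<le> 1" by auto
  have "exp (- b \<kappa> + (\<Sum>m\<in>UNIV. b m)) = (\<Prod>i\<in>UNIV - {\<kappa>}. exp (b i))"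
    by (simp add: sum.remove[of UNIV \<kappa>] exp_sum)
  moreover have "1 / 2 \<le> ?\<theta> ^ (CARD('n) - 1)"
    using half_le_power[of "CARD('n)"] power_decreasing[of "CARD('n) - 1" "CARD('n)" ?\<theta>] \<theta>
    by linarith
  ultimately have "1 / 2 * exp (- b \<kappa> + (\<Sum>m\<in>UNIV. b m))
      \<le> ?\<theta> ^ (CARD('n) - 1) * (\<Prod>i\<in>UNIV - {\<kappa>}. exp (b i))"
    by (intro mult_mono) (auto intro: prod_nonneg)
  also have "\<dots> = (\<Prod>i\<in>UNIV - {\<kappa>}. ?\<theta> * exp (b i))"
    by (simp add: prod.distrib card_Diff_singleton)
  also have "\<dots> \<le> (\<Prod>i\<in>UNIV - {\<kappa>}. norm (perp (lower X b \<kappa> (b i)) (X i)))"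
  proof (intro prod_mono conjI)
    fix i assume i: "i \<in> UNIV - {\<kappa>}"
    then have "?\<theta> * exp (b i) \<le> ?\<theta> * norm (X i)"
      using adm \<theta> by (intro mult_left_mono) (auto simp: admissible_def)
    then show "?\<theta> * exp (b i) \<le> norm (perp (lower X b \<kappa> (b i)) (X i))"
      using admissible_perp_ge[OF adm, of i] i by auto
  qed (use \<theta> in auto)
  finally have "?r * (1 / 2 * exp (- b \<kappa> + (\<Sum>m\<in>UNIV. b m))) \<le> 1"
    using mult_left_mono[of _ _ ?r] one by fastforce
  then show ?thesis
    by (simp add: exp_diff exp_add exp_minus field_simps)
qed

text \<open>Subtract from \<open>u\<close> its component along \<open>perp G y\<close>, which has
  length at most \<open>s\<close>. The result is normal to \<open>insert y G\<close>, and
  normalising it moves it by at most \<open>s\<close> again, hence the factor 2.\<close>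

lemma rotate_normal:
  fixes u y :: "real ^ 'n"
  assumes u: "norm u = 1" "\<And>x. x \<in> insert z G \<Longrightarrow> u \<bullet> x = 0"
    and G: "norm (perp (insert z G) y) \<le> s * norm (perp G y)" "perp G y \<noteq> 0" "s < 1"
  obtains u' where "norm u' = 1" "\<And>x. x \<in> insert y G \<Longrightarrow> u' \<bullet> x = 0" "norm (u' - u) \<le> 2 * s"
proof -
  define q where "q = perp G y"
  have qG: "q \<bullet> x = 0" if "x \<in> G" for x
    unfolding q_def using that by (intro inner_perp_span span_base)
  have qy: "q \<bullet> y = q \<bullet> q"
    by (simp add: q_def inner_perp_self)
  have q0: "q \<bullet> q \<noteq> 0" using G by (simp add: q_def)
  define v where "v = u - ((u \<bullet> y) / (q \<bullet> q)) *\<^sub>R q"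
  have v: "v \<bullet> x = 0" if "x \<in> insert y G" for x
    using that u(2) qG qy q0 by (auto simp: v_def inner_diff_left)
  have "\<bar>u \<bullet> y\<bar> \<le> norm (perp (insert z G) y)"
    using inner_le_norm_perp[of "insert z G" u y] u by auto
  then have uy: "\<bar>u \<bullet> y\<bar> \<le> s * norm q" using G by (simp add: q_def)
  have "norm (v - u) = \<bar>u \<bullet> y\<bar> / norm q"
    using q0 by (simp add: v_def abs_mult power2_norm_eq_inner[symmetric] power2_eq_square)
  also have "\<dots> \<le> s"
    using uy q0 by (simp add: divide_le_eq)
  finally have vu: "norm (v - u) \<le> s" .
  then have nv: "\<bar>1 - norm v\<bar> \<le> s"
    using norm_triangle_ineq3[of v u] u(1) by linarith
  then have v0: "norm v > 0" using G(3) by linarith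
  show thesis
  proof
    show "norm (v /\<^sub>R norm v) = 1" using v0 by simp
    show "(v /\<^sub>R norm v) \<bullet> x = 0" if "x \<in> insert y G" for x
      using v[OF that] by simp
    have "v /\<^sub>R norm v - v = ((1 - norm v) / norm v) *\<^sub>R v"
      using v0 by (simp add: scaleR_diff_left diff_divide_distrib inverse_eq_divide)
    then have "norm (v /\<^sub>R norm v - v) = \<bar>1 - norm v\<bar>"
      using v0 by simp
    then show "norm (v /\<^sub>R norm v - u) \<le> 2 * s"
      using norm_triangle_ineq[of "v /\<^sub>R norm v - v" "v - u"] nv vu by simp
  qed
qed

text \<open>Aim at a vector of the span that is orthogonal to everything but \<open>X i\<close>, and
  round. The coefficient 1 of \<open>X \<kappa>\<close> is what will preserve the
  determinant.\<close>

lemma new_lattice_point: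
  fixes X :: "'n::finite \<Rightarrow> real ^ 'n"
  defines "n \<equiv> real CARD('n)"
  assumes small: "\<And>m. m = \<kappa> \<or> m \<in> J \<Longrightarrow> norm (X m) \<le> 2 * exp (c - \<delta>)"
    and J: "\<kappa> \<notin> J" "i \<in> J" "perp (X ` (J - {i})) (X i) \<noteq> 0"
  obtains d :: "'n \<Rightarrow> int" and y where "y = X \<kappa> + (\<Sum>m\<in>J. of_int (d m) *\<^sub>R X m)"
    and "exp c \<le> norm (perp (X ` (J - {i})) y)"
    and "norm y \<le> (1 + 4 * n * exp (- \<delta>)) * exp c"
proof -
  let ?W = "X ` (J - {i})"
  \<comment> \<open>The rounding error is at most \<open>n\<close> vectors of norm
    \<open>2 * exp (c - \<delta>)\<close>, that is \<open>\<eta> * exp c\<close>. Lengthening the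
    target by the same amount keeps the orthogonal part above \<open>exp c\<close>.\<close>
  define \<eta> where "\<eta> = 2 * n * exp (- \<delta>)"
  define R where "R = (1 + \<eta>) * exp c"
  define p where "p = perp ?W (X i)"
  define v where "v = (R / norm p) *\<^sub>R p"
  have "0 \<le> \<eta>" by (simp add: \<eta>_def n_def)
  then have R: "0 \<le> R" by (simp add: R_def)
  have "p \<in> span (X ` J)"
    unfolding p_def using J(2) by (intro perp_in_span span_base) (auto intro: span_base)
  then have "v \<in> span (X ` J)" by (simp add: v_def span_scale)
  then obtain d :: "'n \<Rightarrow> int" where d: "norm (X \<kappa> + (\<Sum>m\<in>J. of_int (d m) *\<^sub>R X m) - v)
      \<le> norm (X \<kappa>) + (\<Sum>m\<in>J. norm (X m))"
    by (rule lattice_point_near[rotated]) auto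
  define y where "y = X \<kappa> + (\<Sum>m\<in>J. of_int (d m) *\<^sub>R X m)"
  have "norm (y - v) \<le> (\<Sum>m\<in>insert \<kappa> J. norm (X m))"
    using d J(1) by (simp add: y_def)
  also have "\<dots> \<le> (\<Sum>m\<in>insert \<kappa> J. 2 * exp (c - \<delta>))"
    by (intro sum_mono small) auto
  also have "\<dots> \<le> n * (2 * exp (c - \<delta>))"
    unfolding n_def by (simp add: card_mono mult_right_mono)
  also have "\<dots> = \<eta> * exp c"
    by (simp add: \<eta>_def exp_diff exp_minus field_simps)
  finally have e: "norm (y - v) \<le> \<eta> * exp c" .
  have nv: "norm v = R" using R J(3) by (simp add: v_def p_def)
  have "perp ?W v = v"
    by (simp add: v_def p_def perp_scaleR perp_perp)
  then have "v = perp ?W y + perp ?W (v - y)"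
    using perp_add[of ?W y "v - y"] by simp
  then have "R \<le> norm (perp ?W y) + norm (perp ?W (v - y))"
    using nv norm_triangle_ineq by metis
  then have "exp c \<le> norm (perp ?W y)"
    using norm_perp_le[of ?W "v - y"] e by (simp add: norm_minus_commute R_def algebra_simps)
  moreover have "norm y \<le> norm v + norm (y - v)"
    using norm_triangle_ineq[of v "y - v"] by simp
  then have "norm y \<le> (1 + 4 * n * exp (- \<delta>)) * exp c"
    using e by (simp add: nv R_def \<eta>_def algebra_simps)
  ultimately show thesis using that[of y d] by (simp add: y_def)
qed

section \<open>One step of the canvas\<close>

text \<open>\<open>b \<kappa>\<close> is replaced by the new coordinate \<open>c\<close>, and \<open>\<kappa>'\<close> is the label of the
  coordinate that is removed next.\<close>

locale canvas_step =
  fixes \<delta> c :: real and X :: "'n::finite \<Rightarrow> real ^ 'n" and b :: "'n \<Rightarrow> real" and \<kappa> \<kappa>' :: 'n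
  assumes mesh: "8 * real CARD('n) ^ 3 + 16 * (real CARD('n))\<^sup>2 \<le> exp \<delta>"
    and card_ge: "2 \<le> CARD('n)"
    and adm: "admissible \<delta> X b \<kappa>"
    and gap: "\<And>m. m = \<kappa> \<or> b m < c \<Longrightarrow> b m + \<delta> \<le> c"
    and fresh: "\<And>m. m \<noteq> \<kappa> \<Longrightarrow> b m \<noteq> c"
    and next_label: "\<kappa>' \<noteq> \<kappa>" "b \<kappa>' < c"
begin

definition b' :: "'n \<Rightarrow> real" where "b' = b(\<kappa> := c)"

text \<open>The vectors common to the two hyperplanes: the old one also contains
  \<open>X \<kappa>'\<close>, the new one contains the new vector instead.\<close>

definition kept :: "real \<Rightarrow> (real ^ 'n) set" where
  "kept t = X ` {m. m \<noteq> \<kappa> \<and> m \<noteq> \<kappa>' \<and> b m < t}"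

lemma n_ge: "2 \<le> real CARD('n)"
  using card_ge by linarith

text \<open>The first form pays for a step out of one position of \<open>threshold\<close>; the
  second, from \<open>n = 2\<close>, makes the reserve decay.\<close>

lemma exp_mesh: "(8 + 4 * real CARD('n)) * (2 * (real CARD('n))\<^sup>2) * exp (- \<delta>) \<le> 1"
    "exp (- \<delta>) \<le> 1 / 128"
proof -
  show "(8 + 4 * real CARD('n)) * (2 * (real CARD('n))\<^sup>2) * exp (- \<delta>) \<le> 1"
    using mesh by (simp add: exp_minus field_simps power2_eq_square power3_eq_cube)
  have "8 * 2 ^ 3 + 16 * 2\<^sup>2 \<le> 8 * real CARD('n) ^ 3 + 16 * (real CARD('n))\<^sup>2"
    using n_ge by (intro add_mono mult_left_mono power_mono) auto
  then have "128 \<le> exp \<delta>" using mesh by simp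
  then show "exp (- \<delta>) \<le> 1 / 128" by (simp add: exp_minus field_simps)
qed

lemma \<delta>_pos: "0 < \<delta>"
proof (rule ccontr)
  assume "\<not> 0 < \<delta>"
  then have "1 \<le> exp (- \<delta>)" by simp
  then show False using exp_mesh(2) by linarith
qed

lemma b_inj: "inj b" and norm_X: "norm (X m) \<le> 2 * exp (b m)"
  using adm by (auto simp: admissible_def)

lemma b_\<kappa>: "b \<kappa> < c"
  using gap[of \<kappa>] \<delta>_pos by simp

lemma inj_b': "inj b'"
  using b_inj fresh by (auto simp: b'_def inj_on_def)

lemma perp_X_pos:
  assumes "m \<noteq> \<kappa>"
  shows "0 < norm (perp (lower X b \<kappa> (b m)) (X m))"
proof -
  have "0 < exp (b m)" by simp
  also have "exp (b m) \<le> norm (X m)"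
    using adm assms by (auto simp: admissible_def)
  finally have "0 < (1 - 1 / (2 * real CARD('n))) * norm (X m)"
    using n_ge by (intro mult_pos_pos) (auto simp: field_simps)
  then show ?thesis using admissible_perp_ge[OF adm assms] by linarith
qed

text \<open>Split \<open>T\<close> at height \<open>b m\<close>. The part below is contained in
  \<open>lower X b \<kappa> (b m)\<close>; the part above is adjoined by
  \<open>norm_perp_chain\<close> at the cost of a positive factor.\<close>

lemma perp_X_pos':
  assumes "m \<noteq> \<kappa>" "finite T" "m \<notin> T" "\<kappa> \<notin> T"
  shows "perp (X ` T) (X m) \<noteq> 0"
proof -
  let ?\<theta> = "1 - 1 / (2 * real CARD('n))"
  let ?S = "X ` {j \<in> T. b j < b m}" and ?T = "{j \<in> T. b m < b j}"
  have \<theta>: "0 < ?\<theta>" "?\<theta> \<le> 1" using n_ge by (auto simp: field_simps)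
  have sub: "insert (X m) (?S \<union> X ` {m'\<in>?T. b m' < b j}) \<subseteq> lower X b \<kappa> (b j)" if "j \<in> ?T" for j
    using assms that by (auto simp: lower_def)
  have "?\<theta> ^ card ?T * norm (perp ?S (X m)) \<le> norm (perp (?S \<union> X ` ?T) (X m))"
  proof (rule norm_perp_chain)
    show "inj_on b ?T" using b_inj inj_on_subset by blast
    fix j assume j: "j \<in> ?T"
    then have "?\<theta> * norm (X j) \<le> norm (perp (lower X b \<kappa> (b j)) (X j))"
      using assms by (intro admissible_perp_ge[OF adm]) auto
    also have "\<dots> \<le> norm (perp (insert (X m) (?S \<union> X ` {m'\<in>?T. b m' < b j})) (X j))"
      using sub[OF j] span_superset by (intro norm_perp_antimono) (rule order_trans)
    finally show "?\<theta> * norm (X j)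
        \<le> norm (perp (insert (X m) (?S \<union> X ` {m'\<in>?T. b m' < b j})) (X j))" .
  qed (use \<theta> assms in auto)
  moreover have "T = {j \<in> T. b j < b m} \<union> ?T"
    using assms(3) b_inj by (auto simp: inj_on_def) (metis linorder_neqE_linordered_idom)
  then have "?S \<union> X ` ?T = X ` T" by (metis image_Un)
  moreover have "0 < norm (perp ?S (X m))"
  proof -
    have "?S \<subseteq> lower X b \<kappa> (b m)" using assms by (auto simp: lower_def)
    then have "norm (perp (lower X b \<kappa> (b m)) (X m)) \<le> norm (perp ?S (X m))"
      using span_superset by (intro norm_perp_antimono) (rule order_trans)
    then show ?thesis using perp_X_pos[OF assms(1)] by linarith
  qed
  then have "0 < ?\<theta> ^ card ?T * norm (perp ?S (X m))"
    using \<theta> by (intro mult_pos_pos) auto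
  ultimately show ?thesis by force
qed

text \<open>Integral coefficients, with 1 at \<open>X \<kappa>\<close>, keep a lattice basis. The
  two norm bounds together say that \<open>y\<close> has the prescribed length and is nearly
  orthogonal to the shorter vectors that stay.\<close>

definition good :: "real ^ 'n \<Rightarrow> bool" where
  "good y \<longleftrightarrow>
     (\<exists>d::'n \<Rightarrow> int. y = X \<kappa> + (\<Sum>m | m \<noteq> \<kappa> \<and> b m < c. of_int (d m) *\<^sub>R X m)) \<and>
     exp c \<le> norm (perp (kept c) y) \<and> norm y \<le> (1 + 4 * real CARD('n) * exp (- \<delta>)) * exp c"

lemma good_exists: "\<exists>y. good y"
proof -
  let ?J = "{m. m \<noteq> \<kappa> \<and> b m < c}"
  have "?J - {\<kappa>'} = {m. m \<noteq> \<kappa> \<and> m \<noteq> \<kappa>' \<and> b m < c}" by auto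
  then have kept: "X ` (?J - {\<kappa>'}) = kept c" by (simp add: kept_def)
  have small: "norm (X m) \<le> 2 * exp (c - \<delta>)" if "m = \<kappa> \<or> m \<in> ?J" for m
  proof -
    have "b m \<le> c - \<delta>" using gap[of m] that by force
    then show ?thesis using norm_X[of m] by (smt (verit) exp_le_cancel_iff)
  qed
  have "perp (X ` (?J - {\<kappa>'})) (X \<kappa>') \<noteq> 0"
    using next_label by (intro perp_X_pos') auto
  with small obtain d :: "'n \<Rightarrow> int" and y where "y = X \<kappa> + (\<Sum>m\<in>?J. of_int (d m) *\<^sub>R X m)"
    "exp c \<le> norm (perp (X ` (?J - {\<kappa>'})) y)" "norm y \<le> (1 + 4 * real CARD('n) * exp (- \<delta>)) * exp c"
    using next_label by (elim new_lattice_point[of \<kappa> ?J X c \<delta> \<kappa>']) auto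
  then show ?thesis unfolding good_def kept by blast
qed

context
  fixes y :: "real ^ 'n"
  assumes y: "good y"
begin

definition X' :: "'n \<Rightarrow> real ^ 'n" where "X' = X(\<kappa> := y)"

lemma perp_y_ge: "exp c \<le> norm (perp (kept c) y)"
  and norm_y_le: "norm y \<le> (1 + 4 * real CARD('n) * exp (- \<delta>)) * exp c"
  using y by (auto simp: good_def)

lemma y_diff: "y - X \<kappa> \<in> span (lower X b \<kappa> c)"
proof -
  obtain d :: "'n \<Rightarrow> int"
    where d: "y = X \<kappa> + (\<Sum>m | m \<noteq> \<kappa> \<and> b m < c. of_int (d m) *\<^sub>R X m)"
    using y by (auto simp: good_def)
  have "(\<Sum>m | m \<noteq> \<kappa> \<and> b m < c. of_int (d m) *\<^sub>R X m) \<in> span (lower X b \<kappa> c)"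
    by (intro span_sum span_scale span_base) (auto simp: lower_def)
  then show ?thesis by (simp add: d)
qed

lemma lower_old: "b \<kappa>' < t \<Longrightarrow> lower X b \<kappa> t = insert (X \<kappa>') (kept t)"
  using next_label by (auto simp: lower_def kept_def)

lemma lower_new: "lower X' b' \<kappa>' t = (if c < t then insert y (kept t) else kept t)"
  using next_label by (auto simp: lower_def kept_def X'_def b'_def)

text \<open>\<open>y\<close> and \<open>X \<kappa>\<close> agree modulo the hyperplane vectors below
  \<open>c\<close>. Thus \<open>y\<close>, although long, deviates from the old spans no more than
  \<open>X \<kappa>\<close> did.\<close>

lemma perp_lower_y: "c \<le> t \<Longrightarrow> perp (lower X b \<kappa> t) y = perp (lower X b \<kappa> t) (X \<kappa>)"
proof -
  assume "c \<le> t"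
  then have "lower X b \<kappa> c \<subseteq> lower X b \<kappa> t" by (auto simp: lower_def)
  then have "y - X \<kappa> \<in> span (lower X b \<kappa> t)"
    using y_diff span_mono by blast
  from perp_add_span[OF this, of "X \<kappa>"] show ?thesis by simp
qed

lemma threshold_above: "c < b j \<Longrightarrow> threshold b' j = threshold b j"
proof -
  assume "c < b j"
  then have "{m. b' m < b' j} = {m. b m < b j}"
    using b_\<kappa> by (auto simp: b'_def)
  then show ?thesis by (simp add: threshold_def)
qed

text \<open>A label overtaken by the moving coordinate drops one position; its threshold falls by
  \<open>1 / (2 * n\<^sup>2)\<close>, which is the budget for this step.\<close>

lemma threshold_below:
  assumes "j \<noteq> \<kappa>" "b j < c"
  shows "threshold b' j = (if b \<kappa> < b j then threshold b j - 1 / (2 * (real CARD('n))\<^sup>2) else threshold b j)"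
proof -
  have "{m. b' m < b' j} = {m. b m < b j} - {\<kappa>}"
    using assms by (auto simp: b'_def)
  then have "card {m. b' m < b' j} = (if b \<kappa> < b j then card {m. b m < b j} - 1 else card {m. b m < b j})"
    by (auto simp: card_Diff_singleton)
  moreover have "0 < card {m. b m < b j}" if "b \<kappa> < b j"
    using that by (auto simp: card_gt_0_iff)
  ultimately show ?thesis
    by (auto simp: threshold_def of_nat_diff Suc_leI diff_divide_distrib add_divide_distrib)
qed

lemma reserve_le': "reserve \<delta> X' b' \<kappa>' j \<le> 8 * exp (- \<delta>)"
  using norm_X[of \<kappa>'] next_label by (intro reserve_le) (auto simp: X'_def b'_def)

text \<open>One position of \<open>threshold\<close> covers both the imperfect orthogonality of the
  new vector and a full reserve.\<close>

lemma loss_le: "4 * real CARD('n) * exp (- \<delta>) + 8 * exp (- \<delta>) \<le> 1 / (2 * (real CARD('n))\<^sup>2)"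
  using exp_mesh(1) n_ge by (simp add: field_simps)

lemma loss_le_1: "4 * real CARD('n) * exp (- \<delta>) \<le> 1"
proof -
  have "1 \<le> (real CARD('n))\<^sup>2"
    using n_ge by (intro one_le_power) auto
  then have "1 \<le> 2 * (real CARD('n))\<^sup>2" by linarith
  then have "1 / (2 * (real CARD('n))\<^sup>2) \<le> 1" by (simp add: divide_le_eq)
  then show ?thesis using loss_le exp_gt_zero[of "- \<delta>"] by linarith
qed

text \<open>Every threshold is at least one position below 1, which leaves room for the ratio
  \<open>1 + 4 * n * exp (- \<delta>)\<close> of the two norm bounds on \<open>y\<close> and for the
  reserve.\<close>

lemma new_at:
  "(threshold b' \<kappa> + reserve \<delta> X' b' \<kappa>' \<kappa>) * norm y \<le> norm (perp (lower X' b' \<kappa>' c) y)"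
proof -
  let ?\<eta> = "4 * real CARD('n) * exp (- \<delta>)"
  have "threshold b' \<kappa> + reserve \<delta> X' b' \<kappa>' \<kappa> \<le> 1 - ?\<eta>"
    using threshold_bounds(2)[of b' \<kappa>] reserve_le'[of \<kappa>] loss_le by simp
  then have "(threshold b' \<kappa> + reserve \<delta> X' b' \<kappa>' \<kappa>) * norm y \<le> (1 - ?\<eta>) * norm y"
    by (intro mult_right_mono) auto
  also have "\<dots> \<le> (1 - ?\<eta>) * ((1 + ?\<eta>) * exp c)"
  proof (rule mult_left_mono[OF norm_y_le])
    show "0 \<le> 1 - ?\<eta>" using loss_le_1 by simp
  qed
  also have "\<dots> \<le> exp c"
    by (simp add: algebra_simps)
  also have "\<dots> \<le> norm (perp (lower X' b' \<kappa>' c) y)"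
    using perp_y_ge by (simp add: lower_new)
  finally show ?thesis .
qed

text \<open>Below \<open>c\<close> the set of shorter hyperplane vectors only shrinks, so distances
  do not decrease. Only a refilled reserve has to be paid for: by the lost position if
  \<open>j\<close> is overtaken, and otherwise by the old reserve, which was already
  maximal.\<close>

lemma new_below:
  assumes "j \<noteq> \<kappa>" "j \<noteq> \<kappa>'" "b j < c"
  shows "(threshold b' j + reserve \<delta> X' b' \<kappa>' j) * norm (X j)
    \<le> norm (perp (lower X' b' \<kappa>' (b j)) (X j))"
proof -
  have "threshold b' j + reserve \<delta> X' b' \<kappa>' j \<le> threshold b j + reserve \<delta> X b \<kappa> j"
  proof (cases "b \<kappa> < b j")
    case True
    have "8 * exp (- \<delta>) \<le> 1 / (2 * (real CARD('n))\<^sup>2)" using loss_le n_ge by (smt (verit) exp_gt_zero mult_nonneg_nonneg)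
    then show ?thesis
      using threshold_below[OF assms(1,3)] reserve_le'[of j] reserve_nonneg[of \<delta> X b \<kappa> j] True
      by simp
  next
    case False
    then show ?thesis
      using threshold_below[OF assms(1,3)] reserve_le'[of j] by (simp add: reserve_def)
  qed
  then have "(threshold b' j + reserve \<delta> X' b' \<kappa>' j) * norm (X j)
      \<le> (threshold b j + reserve \<delta> X b \<kappa> j) * norm (X j)"
    by (intro mult_right_mono) auto
  also have "\<dots> \<le> norm (perp (lower X b \<kappa> (b j)) (X j))"
    using adm assms by (auto simp: admissible_def)
  also have "\<dots> \<le> norm (perp (kept (b j)) (X j))"
    by (intro norm_perp_antimono) (auto simp: kept_def lower_def intro: span_base)
  finally show ?thesis using assms by (simp add: lower_new)
qed

text \<open>The new vector stays far from the kept vectors even after those above \<open>c\<close>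
  are adjoined. The required near orthogonality is a premise, because it is available only for
  smaller labels during the induction in \<open>new_above\<close>.\<close>

lemma perp_kept_y_ge:
  assumes "c \<le> t"
    and claim: "\<And>j. c < b j \<Longrightarrow> b j < t \<Longrightarrow>
      (1 - 1 / (2 * real CARD('n))) * norm (X j) \<le> norm (perp (insert y (kept (b j))) (X j))"
  shows "exp c / 2 \<le> norm (perp (kept t) y)"
proof -
  let ?\<theta> = "1 - 1 / (2 * real CARD('n))" and ?T = "{j. c < b j \<and> b j < t}"
  have \<theta>: "0 < ?\<theta>" "?\<theta> \<le> 1" using n_ge by (auto simp: field_simps)
  have kept: "kept c \<union> X ` {j. c < b j \<and> b j < s} = kept s" if "c \<le> s" for s
  proof -
    have "{m. m \<noteq> \<kappa> \<and> m \<noteq> \<kappa>' \<and> b m < c} \<union> {j. c < b j \<and> b j < s}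
        = {m. m \<noteq> \<kappa> \<and> m \<noteq> \<kappa>' \<and> b m < s}"
      using that b_\<kappa> next_label fresh by (force simp: not_less le_less)
    then show ?thesis by (simp add: kept_def flip: image_Un)
  qed
  have "?\<theta> ^ card ?T * norm (perp (kept c) y) \<le> norm (perp (kept c \<union> X ` ?T) y)"
  proof (rule norm_perp_chain)
    show "inj_on b ?T" using b_inj inj_on_subset by blast
    fix j assume j: "j \<in> ?T"
    then have "{m' \<in> ?T. b m' < b j} = {m. c < b m \<and> b m < b j}" by auto
    then show "?\<theta> * norm (X j) \<le> norm (perp (insert y (kept c \<union> X ` {m'\<in>?T. b m' < b j})) (X j))"
      using claim[of j] kept[of "b j"] j by simp
  qed (use \<theta> in auto)
  moreover have "1 / 2 \<le> ?\<theta> ^ card ?T"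
  proof -
    have "card ?T \<le> CARD('n)" by (rule card_mono) auto
    then have "?\<theta> ^ CARD('n) \<le> ?\<theta> ^ card ?T" using \<theta> by (intro power_decreasing) auto
    then show ?thesis using half_le_power[of "CARD('n)"] by linarith
  qed
  then have "1 / 2 * exp c \<le> ?\<theta> ^ card ?T * norm (perp (kept c) y)"
    using perp_y_ge by (intro mult_mono) auto
  ultimately show ?thesis using kept[OF assms(1)] by simp
qed

text \<open>For a vector longer than \<open>y\<close> the lower span turns from \<open>?E\<close> to
  \<open>insert y ?G\<close>. With \<open>\<rho>\<close> the relative distance of
  \<open>X \<kappa>\<close> to \<open>?E\<close>, the old reserve is
  \<open>4 * exp (- \<delta>) * \<rho>\<close>: one half pays for the turn, the other half bounds
  the new reserve.\<close>

lemma new_above: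
  assumes "c < b j"
  shows "(threshold b' j + reserve \<delta> X' b' \<kappa>' j) * norm (X j)
    \<le> norm (perp (lower X' b' \<kappa>' (b j)) (X j))"
  using assms
proof (induction "card {m. b m < b j}" arbitrary: j rule: less_induct)
  case less
  let ?G = "kept (b j)" and ?E = "lower X b \<kappa> (b j)"
  let ?r = "norm (perp ?E (X \<kappa>))" and ?a = "norm (perp ?G y)"
  have j: "j \<noteq> \<kappa>" "b \<kappa>' < b j" "b \<kappa> < b j" using less.prems b_\<kappa> next_label by auto
  have E: "?E = insert (X \<kappa>') ?G" by (rule lower_old) fact
  have E': "lower X' b' \<kappa>' (b j) = insert y ?G" using less.prems by (simp add: lower_new)
  \<comment> \<open>The vectors between \<open>c\<close> and \<open>b j\<close> have smaller rank,
    so the induction hypothesis supplies their near orthogonality to \<open>y\<close>.\<close>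
  have a: "exp c / 2 \<le> ?a"
  proof (rule perp_kept_y_ge)
    fix i assume i: "c < b i" "b i < b j"
    then have "{m. b m < b i} \<subset> {m. b m < b j}" by auto
    then have "card {m. b m < b i} < card {m. b m < b j}" by (simp add: psubset_card_mono)
    then have "(threshold b' i + reserve \<delta> X' b' \<kappa>' i) * norm (X i)
        \<le> norm (perp (lower X' b' \<kappa>' (b i)) (X i))"
      using less.hyps i by blast
    moreover have "(1 - 1 / (2 * real CARD('n))) * norm (X i) \<le> (threshold b' i + reserve \<delta> X' b' \<kappa>' i) * norm (X i)"
      using threshold_bounds(1)[of b' i] reserve_nonneg[of \<delta> X' b' \<kappa>' i]
      by (intro mult_right_mono) auto
    ultimately show "(1 - 1 / (2 * real CARD('n))) * norm (X i) \<le> norm (perp (insert y (kept (b i))) (X i))"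
      using i by (simp add: lower_new)
  qed (use less.prems in simp)
  then have a0: "0 < ?a" by (smt (verit) exp_gt_zero divide_pos_pos)
  have c: "exp c \<ge> exp \<delta> * exp (b \<kappa>)"
    using gap[of \<kappa>] by (simp flip: exp_add)
  define \<rho> where "\<rho> = ?r / exp (b \<kappa>)"
  have \<rho>: "0 \<le> \<rho>" by (simp add: \<rho>_def)
  have ra: "?r / ?a \<le> 2 * exp (- \<delta>) * \<rho>"
  proof -
    have "exp \<delta> * exp (b \<kappa>) / 2 \<le> ?a" using a c by linarith
    then have "?r / ?a \<le> ?r / (exp \<delta> * exp (b \<kappa>) / 2)"
      by (intro divide_left_mono mult_pos_pos a0) auto
    then show ?thesis by (simp add: \<rho>_def exp_minus field_simps)
  qed
  have Ey: "norm (perp ?E y) = ?r"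
    using perp_lower_y[of "b j"] less.prems by simp
  \<comment> \<open>The next exceptional vector is close to the new span because \<open>y\<close> is
    close to the old one: the exchange identity relates the two distances.\<close>
  have "norm (perp (insert y ?G) (X \<kappa>')) * ?a = ?r * norm (perp ?G (X \<kappa>'))"
    using perp_insert_swap[of y ?G "X \<kappa>'"] Ey E by simp
  also have "\<dots> \<le> ?r * (2 * exp (b \<kappa>'))"
    using norm_perp_le norm_X order_trans by (intro mult_left_mono) (blast, simp)
  finally have "norm (perp (insert y ?G) (X \<kappa>')) / exp (b \<kappa>') \<le> 2 * (?r / ?a)"
    using a0 by (simp add: field_simps)
  then have "norm (perp (insert y ?G) (X \<kappa>')) / exp (b \<kappa>') \<le> 4 * exp (- \<delta>) * \<rho>"
    using ra by linarith
  then have "4 * exp (- \<delta>) * (norm (perp (insert y ?G) (X \<kappa>')) / exp (b \<kappa>'))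
      \<le> 4 * exp (- \<delta>) * (4 * exp (- \<delta>) * \<rho>)"
    by (intro mult_left_mono) auto
  moreover have "reserve \<delta> X' b' \<kappa>' j
      = 4 * exp (- \<delta>) * (norm (perp (insert y ?G) (X \<kappa>')) / exp (b \<kappa>'))"
  proof -
    have "b' \<kappa>' < b' j" "b' j = b j" "b' \<kappa>' = b \<kappa>'" "X' \<kappa>' = X \<kappa>'"
      using j next_label by (auto simp: b'_def X'_def)
    then show ?thesis by (simp add: reserve_def E')
  qed
  moreover have "4 * exp (- \<delta>) * (4 * exp (- \<delta>) * \<rho>) \<le> 2 * exp (- \<delta>) * \<rho>"
  proof -
    have "4 * exp (- \<delta>) * (4 * exp (- \<delta>) * \<rho>) = (16 * exp (- \<delta>)) * (exp (- \<delta>) * \<rho>)" by simp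
    also have "\<dots> \<le> 2 * (exp (- \<delta>) * \<rho>)"
      using exp_mesh(2) \<rho> by (intro mult_right_mono) auto
    finally show ?thesis by simp
  qed
  moreover have "reserve \<delta> X b \<kappa> j = 4 * exp (- \<delta>) * \<rho>"
    using j by (simp add: reserve_def \<rho>_def)
  ultimately have "threshold b' j + reserve \<delta> X' b' \<kappa>' j
      \<le> threshold b j + reserve \<delta> X b \<kappa> j - ?r / ?a"
    using ra threshold_above[OF less.prems] by linarith
  then have "(threshold b' j + reserve \<delta> X' b' \<kappa>' j) * norm (X j)
      \<le> (threshold b j + reserve \<delta> X b \<kappa> j - ?r / ?a) * norm (X j)"
    by (intro mult_right_mono) auto
  also have "\<dots> = (threshold b j + reserve \<delta> X b \<kappa> j) * norm (X j) - norm (X j) * ?r / ?a"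
    by (simp add: left_diff_distrib)
  also have "\<dots> \<le> norm (perp ?E (X j)) - norm (X j) * ?r / ?a"
    using adm j by (auto simp: admissible_def)
  also have "\<dots> \<le> norm (perp (insert y ?G) (X j))"
    using norm_perp_insert_ge[of ?G y "X \<kappa>'" "X j"] a0 Ey E by simp
  finally show ?case using E' by simp
qed

lemma admissible_new: "admissible \<delta> X' b' \<kappa>'"
  unfolding admissible_def
proof (intro conjI allI impI)
  show "inj b'" by (rule inj_b')
  obtain d :: "'n \<Rightarrow> int"
    where d: "y = X \<kappa> + (\<Sum>m | m \<noteq> \<kappa> \<and> b m < c. of_int (d m) *\<^sub>R X m)"
    using y by (auto simp: good_def)
  have X_int: "X m \<in> int_lattice" for m using adm by (simp add: admissible_def)
  then have "y \<in> int_lattice"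
    unfolding d int_lattice_def by (auto intro!: Ints_add Ints_sum Ints_mult)
  then show "X' m \<in> int_lattice" for m
    using X_int by (simp add: X'_def)
  have "y - X \<kappa> \<in> span (X ` (- {\<kappa>}))"
    using y_diff span_mono[of "lower X b \<kappa> c" "X ` (- {\<kappa>})"] by (auto simp: lower_def)
  from det_update_add_span[OF this] show "\<bar>det (\<chi> m. X' m)\<bar> = 1"
    using adm by (simp add: X'_def admissible_def)
  have "norm y \<le> 2 * exp c"
    by (intro order_trans[OF norm_y_le mult_right_mono]) (use loss_le_1 in auto)
  then show "norm (X' m) \<le> 2 * exp (b' m)" for m
    using norm_X by (simp add: X'_def b'_def)
  have "exp c \<le> norm y" using perp_y_ge norm_perp_le order_trans by blast
  then show "exp (b' m) \<le> norm (X' m)" if "m \<noteq> \<kappa>'" for m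
    using adm that by (auto simp: X'_def b'_def admissible_def)
  fix j assume j: "j \<noteq> \<kappa>'"
  show "(threshold b' j + reserve \<delta> X' b' \<kappa>' j) * norm (X' j)
      \<le> norm (perp (lower X' b' \<kappa>' (b' j)) (X' j))"
  proof (cases "j = \<kappa>")
    case True
    then show ?thesis using new_at by (simp add: X'_def b'_def)
  next
    case False
    then show ?thesis
      using new_above[of j] new_below[of j] fresh[of j] j by (force simp: X'_def b'_def)
  qed
qed

text \<open>The sine of the turn is the distance of \<open>y\<close> to the old hyperplane, bounded
  by the covolume estimate, over its distance to the intersection of the two hyperplanes, which is
  at least \<open>exp c / 2\<close>.\<close>

lemma normal_new:
  assumes u: "norm u = 1" "\<And>m. m \<noteq> \<kappa> \<Longrightarrow> u \<bullet> X m = 0" and q: "0 \<le> (\<Sum>m\<in>UNIV. b m)"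
  obtains u' where "norm u' = 1" "\<And>m. m \<noteq> \<kappa>' \<Longrightarrow> u' \<bullet> X' m = 0"
    "norm (u' - u) \<le> 8 * exp (- (\<Sum>m\<in>UNIV. b' m))"
proof -
  \<comment> \<open>A height above all coordinates, so that \<open>lower X b \<kappa> t\<close>
    spans the whole old hyperplane.\<close>
  define t where "t = max c (Max (range b)) + 1"
  have t: "c \<le> t" "b m < t" for m
  proof -
    have "b m \<le> Max (range b)" by (intro Max_ge) auto
    then show "c \<le> t" "b m < t" unfolding t_def by linarith+
  qed
  let ?s = "4 * exp (- (\<Sum>m\<in>UNIV. b' m))"
  have sum': "(\<Sum>m\<in>UNIV. b' m) = (\<Sum>m\<in>UNIV. b m) - b \<kappa> + c"
    by (simp add: b'_def sum.remove[of UNIV \<kappa>] cong: sum.cong_simp)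
  have a: "exp c / 2 \<le> norm (perp (kept t) y)"
  proof (rule perp_kept_y_ge[OF t(1)])
    fix i assume i: "c < b i"
    then have "i \<noteq> \<kappa>" "i \<noteq> \<kappa>'" using b_\<kappa> next_label by auto
    then have "X' i = X i" "b' i = b i" by (simp_all add: X'_def b'_def)
    then show "(1 - 1 / (2 * real CARD('n))) * norm (X i) \<le> norm (perp (insert y (kept (b i))) (X i))"
      using admissible_perp_ge[OF admissible_new \<open>i \<noteq> \<kappa>'\<close>] i by (simp add: lower_new)
  qed
  have "lower X b \<kappa> t = X ` (- {\<kappa>})" using t by (auto simp: lower_def)
  then have E: "insert (X \<kappa>') (kept t) = X ` (- {\<kappa>})"
    using lower_old t by metis
  have "norm (perp (insert (X \<kappa>') (kept t)) y) = norm (perp (X ` (- {\<kappa>})) (X \<kappa>))"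
    using perp_lower_y[OF t(1)] lower_old[of t] t E by simp
  also have "\<dots> \<le> 2 * exp (b \<kappa> - (\<Sum>m\<in>UNIV. b m))"
    by (rule admissible_covolume[OF adm])
  also have "\<dots> = ?s * (exp c / 2)"
    by (simp add: sum' flip: exp_add)
  also have "\<dots> \<le> ?s * norm (perp (kept t) y)"
    using a by (intro mult_left_mono) auto
  finally have s: "norm (perp (insert (X \<kappa>') (kept t)) y) \<le> ?s * norm (perp (kept t) y)" .
  \<comment> \<open>The coordinate sum was nonnegative and grows by at least
    \<open>\<delta>\<close>; this keeps the sine below 1.\<close>
  have "exp (- (\<Sum>m\<in>UNIV. b' m)) \<le> exp (- \<delta>)"
    using q gap[of \<kappa>] by (simp add: sum')
  then have s1: "?s < 1" using exp_mesh(2) by linarith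
  have "0 < norm (perp (kept t) y)" using a by (smt (verit) exp_gt_zero divide_pos_pos)
  then have ne: "perp (kept t) y \<noteq> 0" by auto
  have orth: "u \<bullet> x = 0" if "x \<in> insert (X \<kappa>') (kept t)" for x
    using that u(2) unfolding E by auto
  obtain u' where u': "norm u' = 1" "\<And>x. x \<in> insert y (kept t) \<Longrightarrow> u' \<bullet> x = 0"
    "norm (u' - u) \<le> 2 * ?s"
    using rotate_normal[OF u(1) orth s ne s1] by blast
  have "X' m \<in> insert y (kept t)" if "m \<noteq> \<kappa>'" for m
    using that t by (auto simp: X'_def kept_def)
  with u' show thesis by (intro that) auto
qed

end

text \<open>The normal is quantified after the basis, since the new basis is determined without
  reference to it.\<close>

lemma step:
  assumes q: "0 \<le> (\<Sum>m\<in>UNIV. b m)"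
  obtains Y where "admissible \<delta> Y (b(\<kappa> := c)) \<kappa>'"
    and "\<And>u. norm u = 1 \<Longrightarrow> (\<And>m. m \<noteq> \<kappa> \<Longrightarrow> u \<bullet> X m = 0) \<Longrightarrow>
      \<exists>u'. norm u' = 1 \<and> (\<forall>m. m \<noteq> \<kappa>' \<longrightarrow> u' \<bullet> Y m = 0) \<and>
        norm (u' - u) \<le> 8 * exp (- (\<Sum>m\<in>UNIV. (b(\<kappa> := c)) m))"
proof -
  obtain y where y: "good y" using good_exists ..
  show thesis
  proof (rule that)
    show "admissible \<delta> (X' y) (b(\<kappa> := c)) \<kappa>'"
      using admissible_new[OF y] by (simp add: b'_def)
    fix u assume "norm u = 1" "\<And>m. m \<noteq> \<kappa> \<Longrightarrow> u \<bullet> X m = 0"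
    then show "\<exists>u'. norm u' = 1 \<and> (\<forall>m. m \<noteq> \<kappa>' \<longrightarrow> u' \<bullet> X' y m = 0) \<and>
        norm (u' - u) \<le> 8 * exp (- (\<Sum>m\<in>UNIV. (b(\<kappa> := c)) m))"
      using normal_new[OF y _ _ q] unfolding b'_def by metis
  qed
qed

end

section \<open>The starting basis\<close>

lemma rank_enumeration:
  fixes f :: "'n::finite \<Rightarrow> real"
  assumes "inj f"
  obtains h :: "'n \<Rightarrow> nat" where "bij_betw h UNIV {..<CARD('n)}" "\<And>i j. h i < h j \<longleftrightarrow> f i < f j"
proof
  define h where "h m = card {j. f j < f m}" for m
  have mono: "h i < h j" if "f i < f j" for i j
    unfolding h_def using that by (intro psubset_card_mono) auto
  show iff: "h i < h j \<longleftrightarrow> f i < f j" for i j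
    using mono[of i j] mono[of j i] by (cases "f i" "f j" rule: linorder_cases) (auto simp: h_def)
  have inj: "inj h"
    using assms iff by (metis injD injI less_irrefl linorder_neqE_linordered_idom)
  have "h m < CARD('n)" for m
    unfolding h_def by (intro psubset_card_mono) auto
  then have "h ` UNIV \<subseteq> {..<CARD('n)}" by auto
  moreover have "card (h ` UNIV) = card {..<CARD('n)}"
    using card_image[OF inj] by simp
  ultimately have "h ` UNIV = {..<CARD('n)}" by (intro card_subset_eq) auto
  with inj show "bij_betw h UNIV {..<CARD('n)}" by (simp add: bij_betw_def)
qed

text \<open>The starting basis is \<open>M m *\<^sub>R axis m 1 + axis (pred m) 1\<close>, where \<open>pred m\<close> is the label
  preceding \<open>m\<close> when \<open>\<kappa>\<close> is moved to the front; the vector with label \<open>\<kappa>\<close> closes the chain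
  and makes the determinant \<open>1\<close> up to sign.\<close>

lemma admissible_start:
  fixes b :: "'n::finite \<Rightarrow> real"
  assumes mesh: "8 * real CARD('n) ^ 3 + 16 * (real CARD('n))\<^sup>2 \<le> exp \<delta>"
    and card_ge: "2 \<le> CARD('n)" and b: "inj b" "\<And>m. \<delta> \<le> b m"
  obtains X u where "admissible \<delta> X b \<kappa>" "norm u = 1" "\<And>m. m \<noteq> \<kappa> \<Longrightarrow> u \<bullet> X m = 0"
proof -
  define n where "n = real CARD('n)"
  have n: "2 \<le> n" using card_ge unfolding n_def by linarith
  have loss: "8 * exp (- \<delta>) + exp (- \<delta>) \<le> 1 / (2 * n\<^sup>2)"
  proof -
    have "18 * n\<^sup>2 \<le> 16 * n\<^sup>2 + 8 * n ^ 3"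
      using n by (simp add: power2_eq_square power3_eq_cube)
    also have "\<dots> \<le> exp \<delta>" using mesh by (simp add: n_def)
    finally show ?thesis using n by (simp add: exp_minus field_simps)
  qed
  define f where "f m = (if m = \<kappa> then Min (range b) - 1 else b m)" for m
  have f\<kappa>: "Min (range b) - 1 < b m" for m
  proof -
    have "Min (range b) \<le> b m" by (intro Min_le) auto
    then show ?thesis by linarith
  qed
  then have f\<kappa>': "b m \<noteq> Min (range b) - 1" for m by (metis less_irrefl)
  have "inj f"
    unfolding f_def inj_on_def using b(1) f\<kappa>' by (metis injD)
  then obtain h where h: "bij_betw h UNIV {..<CARD('n)}" "\<And>i j. h i < h j \<longleftrightarrow> f i < f j"
    by (rule rank_enumeration) blast
  define g where "g = inv h"
  have inj_h: "inj h" using h(1) by (simp add: bij_betw_def)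
  have gh: "g (h m) = m" for m using inj_h by (simp add: g_def)
  have hg: "h (g t) = t" if "t < CARD('n)" for t
    using h(1) that unfolding g_def bij_betw_def by (intro f_inv_into_f) auto
  have h_lt: "h m < CARD('n)" for m
    using h(1) by (auto simp: bij_betw_def)
  have h_pos: "h \<kappa> < h m" if "m \<noteq> \<kappa>" for m
    using that f\<kappa> by (simp add: h(2) f_def)
  have h_less: "h i < h j \<longleftrightarrow> b i < b j" if "i \<noteq> \<kappa>" "j \<noteq> \<kappa>" for i j
    using that by (simp add: h(2) f_def)
  define M where "M m = real_of_int \<lceil>exp (b m)\<rceil>" for m
  define e where "e m = (axis m 1 :: real ^ 'n)" for m
  have e: "e i \<bullet> e j = (if i = j then 1 else 0)" for i j
    by (simp add: e_def inner_axis_axis)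
  have ne: "norm (e i) = 1" for i by (simp add: e_def)
  define X where "X m = (if m = \<kappa> then e (g (CARD('n) - 1)) else M m *\<^sub>R e m + e (g (h m - 1)))" for m
  have M: "exp (b m) \<le> M m" "M m \<le> exp (b m) + 1" "exp \<delta> \<le> exp (b m)" "128 \<le> exp \<delta>" for m
  proof -
    show "exp (b m) \<le> M m" "M m \<le> exp (b m) + 1" by (simp_all add: M_def)
    show "exp \<delta> \<le> exp (b m)" using b(2) by simp
    have "8 * 2 ^ 3 + 16 * 2\<^sup>2 \<le> 8 * n ^ 3 + 16 * n\<^sup>2"
      using n by (intro add_mono mult_left_mono power_mono) auto
    then show "128 \<le> exp \<delta>" using mesh by (simp add: n_def)
  qed
  have M0: "0 \<le> M m" for m using M(1)[of m] by (meson exp_ge_zero order_trans)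
  have pred: "h (g (h m - 1)) = h m - 1" "h m - 1 < h m" if "m \<noteq> \<kappa>" for m
    using h_pos[OF that] h_lt[of m] by (auto intro: hg)
  have norm_X: "norm (X m) \<le> M m + 1" if "m \<noteq> \<kappa>" for m
    using norm_triangle_ineq[of "M m *\<^sub>R e m" "e (g (h m - 1))"] M0[of m] that
    by (simp add: X_def ne)
  \<comment> \<open>Shorter hyperplane vectors involve only unit vectors of labels preceding
    \<open>m\<close>, so \<open>e m\<close> is normal to all of them and detects the coefficient
    \<open>M m\<close>.\<close>
  have perp_X: "M m \<le> norm (perp (lower X b \<kappa> (b m)) (X m))" if m: "m \<noteq> \<kappa>" for m
  proof -
    have "e m \<bullet> x = 0" if "x \<in> lower X b \<kappa> (b m)" for x
    proof -
      obtain j where j: "j \<noteq> \<kappa>" "b j < b m" "x = X j"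
        using \<open>x \<in> lower X b \<kappa> (b m)\<close> by (auto simp: lower_def)
      then have "h j < h m" using h_less m by simp
      then have "m \<noteq> j" "m \<noteq> g (h j - 1)" using pred[OF j(1)] by auto
      then show ?thesis using j by (simp add: X_def inner_add_right e)
    qed
    then have "\<bar>e m \<bullet> X m\<bar> \<le> norm (e m) * norm (perp (lower X b \<kappa> (b m)) (X m))"
      by (rule inner_le_norm_perp)
    moreover have "g (h m - 1) \<noteq> m" using pred[OF m] by auto
    then have "e m \<bullet> X m = M m" using m by (simp add: X_def inner_add_right e)
    ultimately show ?thesis by (simp add: ne)
  qed
  \<comment> \<open>For the determinant the order is reversed, with \<open>\<kappa>\<close> first:
    each vector then contributes just the unit vector of its predecessor, and all factors are
    1.\<close>
  define F where "F m = (if m = \<kappa> then -1 else real CARD('n) - real (h m))" for m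
  have "inj F"
    using inj_h h_lt by (auto simp: F_def inj_on_def split: if_splits)
      (metis h_lt of_nat_less_iff diff_gt_0_iff_gt neg_less_0_iff_less less_asym zero_less_one)+
  have F_less: "{j. F j < F i} = insert \<kappa> {j. h i < h j}" if "i \<noteq> \<kappa>" for i
    using h_pos that h_lt[of i] by (auto simp: F_def)
  \<comment> \<open>Descend from the end of the chain: \<open>X \<kappa>\<close> is the last unit
    vector, and \<open>X s - M s *\<^sub>R e s\<close> is the unit vector of the label before
    \<open>s\<close>.\<close>
  have span_e: "e i \<in> span (X ` insert \<kappa> {j. h i < h j})" for i
  proof (induction "CARD('n) - h i" arbitrary: i rule: less_induct)
    case less
    show ?case
    proof (cases "h i = CARD('n) - 1")
      case True
      then have "g (CARD('n) - 1) = i" using gh by metis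
      then show ?thesis by (auto simp: X_def intro!: span_base)
    next
      case False
      define s where "s = g (h i + 1)"
      have hs: "h s = h i + 1" using False h_lt[of i] by (simp add: s_def hg)
      then have s: "s \<noteq> \<kappa>" using h_pos[of i] by (cases "i = \<kappa>") auto
      have "e s \<in> span (X ` insert \<kappa> {j. h s < h j})"
        using hs h_lt[of s] by (intro less) simp
      moreover have "X ` insert \<kappa> {j. h s < h j} \<subseteq> X ` insert \<kappa> {j. h i < h j}" using hs by auto
      ultimately have "e s \<in> span (X ` insert \<kappa> {j. h i < h j})" using span_mono by blast
      moreover have "X s \<in> span (X ` insert \<kappa> {j. h i < h j})" using hs by (intro span_base) auto
      ultimately have "X s - M s *\<^sub>R e s \<in> span (X ` insert \<kappa> {j. h i < h j})"
        by (intro span_diff span_scale)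
      then show ?thesis using s hs by (simp add: X_def gh)
    qed
  qed
  have "norm (perp (X ` {j. F j < F i}) (X i)) = 1" for i
  proof (cases "i = \<kappa>")
    case True
    have "{j. F j < F \<kappa>} = {}" using h_lt by (auto simp: F_def not_less)
      (smt (verit) h_lt of_nat_less_iff)
    moreover have "perp {} x = x" for x :: "real ^ 'n" by (rule perp_eqI) auto
    ultimately show ?thesis using True by (simp add: X_def ne)
  next
    case False
    have "perp (X ` {j. F j < F i}) (X i) = e (g (h i - 1))"
    proof (rule perp_eqI)
      show "X i - e (g (h i - 1)) \<in> span (X ` {j. F j < F i})"
        using span_e[of i] False by (simp add: X_def F_less span_scale)
      have base: "e (g (h i - 1)) \<bullet> x = 0" if x: "x \<in> X ` {j. F j < F i}" for x
      proof -
        have p: "h (g (h i - 1)) = h i - 1" "h i - 1 < h i" using pred[OF False] by auto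
        obtain j where j: "j = \<kappa> \<or> h i < h j" "x = X j"
          using x unfolding F_less[OF False] by auto
        show ?thesis
        proof (cases "j = \<kappa>")
          case True
          have "h (g (CARD('n) - 1)) = CARD('n) - 1" by (intro hg) simp
          then have "g (h i - 1) \<noteq> g (CARD('n) - 1)" using p h_lt[of i] by force
          then show ?thesis using True j by (simp add: X_def e)
        next
          case j\<kappa>: False
          then have "h i < h j" using j by simp
          then have "g (h i - 1) \<noteq> j" "g (h i - 1) \<noteq> g (h j - 1)"
            using p pred[OF j\<kappa>] by force+
          then show ?thesis using j\<kappa> j by (simp add: X_def inner_add_right e)
        qed
      qed
      show "e (g (h i - 1)) \<bullet> w = 0" if "w \<in> span (X ` {j. F j < F i})" for w
        using that base by (induction rule: span_induct_alt) (auto simp: inner_add_right)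
    qed
    then show ?thesis by (simp add: ne)
  qed
  then have det: "\<bar>det (\<chi> m. X m)\<bar> = 1"
    using det_eq_prod_perp[OF \<open>inj F\<close>, of X] by simp
  have X\<kappa>: "norm (X \<kappa>) \<le> 2 * exp (b \<kappa>)"
  proof -
    have "1 \<le> 2 * exp (b \<kappa>)" using M(3)[of \<kappa>] M(4) by linarith
    then show ?thesis by (simp add: X_def ne)
  qed
  have "admissible \<delta> X b \<kappa>"
    unfolding admissible_def
  proof (intro conjI allI impI)
    show "inj b" by (rule b)
    show "X m \<in> int_lattice" for m
      by (auto simp: X_def int_lattice_def M_def e_def axis_def)
    show "\<bar>det (\<chi> m. X m)\<bar> = 1" by (rule det)
    show "norm (X m) \<le> 2 * exp (b m)" for m
    proof (cases "m = \<kappa>")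
      case False
      then show ?thesis using norm_X[of m] M(1-3)[of m] M(4) by linarith
    qed (use X\<kappa> in simp)
    show "exp (b m) \<le> norm (X m)" if "m \<noteq> \<kappa>" for m
      using perp_X[OF that] norm_perp_le[of "lower X b \<kappa> (b m)" "X m"] M(1)[of m] by linarith
    fix m assume m: "m \<noteq> \<kappa>"
    \<comment> \<open>The spare \<open>exp (- \<delta>)\<close> compensates for the gap between
      \<open>M m + 1\<close>, which bounds the norm, and the orthogonal part \<open>M m\<close>,
      because \<open>M m\<close> is at least \<open>exp \<delta>\<close>.\<close>
    have "threshold b m + reserve \<delta> X b \<kappa> m \<le> 1 - exp (- \<delta>)"
      using threshold_bounds(2)[of b m] reserve_le[of X \<kappa> b \<delta> m] X\<kappa> loss by (simp add: n_def)
    then have "(threshold b m + reserve \<delta> X b \<kappa> m) * norm (X m) \<le> (1 - exp (- \<delta>)) * norm (X m)"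
      by (intro mult_right_mono) auto
    also have "\<dots> \<le> (1 - exp (- \<delta>)) * (M m + 1)"
    proof (rule mult_left_mono[OF norm_X[OF m]])
      have "1 \<le> exp \<delta>" using M(4) by linarith
      then show "0 \<le> 1 - exp (- \<delta>)" by (simp add: exp_minus field_simps)
    qed
    also have "\<dots> \<le> M m"
    proof -
      have "exp (- \<delta>) * exp \<delta> \<le> exp (- \<delta>) * (M m + 1)"
        using M(1,3)[of m] by (intro mult_left_mono) (linarith, simp)
      then show ?thesis by (simp add: left_diff_distrib flip: exp_add)
    qed
    also have "\<dots> \<le> norm (perp (lower X b \<kappa> (b m)) (X m))" by (rule perp_X[OF m])
    finally show "(threshold b m + reserve \<delta> X b \<kappa> m) * norm (X m)
        \<le> norm (perp (lower X b \<kappa> (b m)) (X m))" .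
  qed
  moreover obtain v :: "real ^ 'n" where v: "v \<noteq> 0" "\<And>y. y \<in> span (X ` (- {\<kappa>})) \<Longrightarrow> orthogonal v y"
  proof (rule orthogonal_to_subspace_exists)
    have "dim (X ` (- {\<kappa>})) \<le> card (X ` (- {\<kappa>}))" by (intro dim_le_card') auto
    also have "\<dots> \<le> card (- {\<kappa>})" by (rule card_image_le) auto
    also have "\<dots> < CARD('n)" by (intro psubset_card_mono) auto
    finally show "dim (X ` (- {\<kappa>})) < DIM(real ^ 'n)" by simp
  qed blast
  have "v \<bullet> X m = 0" if "m \<noteq> \<kappa>" for m
    using v(2)[of "X m"] that by (auto simp: orthogonal_def intro: span_base)
  ultimately show thesis
    using v(1) by (intro that[of X "v /\<^sub>R norm v"]) auto
qed

section \<open>Successive minima\<close>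

lemma mem_dilate_body:
  "x \<in> (\<lambda>x. exp L *\<^sub>R x) ` body u q \<longleftrightarrow> norm x \<le> exp L \<and> \<bar>x \<bullet> u\<bar> \<le> exp (L - q)"
proof
  assume "x \<in> (\<lambda>x. exp L *\<^sub>R x) ` body u q"
  then obtain z where z: "x = exp L *\<^sub>R z" "norm z \<le> 1" "\<bar>z \<bullet> u\<bar> \<le> exp (- q)"
    by (auto simp: body_def)
  then have "exp L * \<bar>z \<bullet> u\<bar> \<le> exp L * exp (- q)" by (intro mult_left_mono) auto
  then show "norm x \<le> exp L \<and> \<bar>x \<bullet> u\<bar> \<le> exp (L - q)"
    using z by (simp add: abs_mult flip: exp_add)
next
  assume x: "norm x \<le> exp L \<and> \<bar>x \<bullet> u\<bar> \<le> exp (L - q)"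
  have "exp (- L) *\<^sub>R x \<in> body u q"
  proof -
    have "exp (- L) * norm x \<le> exp (- L) * exp L" "exp (- L) * \<bar>x \<bullet> u\<bar> \<le> exp (- L) * exp (L - q)"
      using x by (auto intro!: mult_left_mono simp del: mult_le_cancel_left_pos)
    then show ?thesis by (simp add: body_def abs_mult flip: exp_add)
  qed
  moreover have "x = exp L *\<^sub>R (exp (- L) *\<^sub>R x)" by (simp flip: exp_add)
  ultimately show "x \<in> (\<lambda>x. exp L *\<^sub>R x) ` body u q" by blast
qed

lemma finite_int_lattice_ball: "finite {x :: real ^ 'n::finite. x \<in> int_lattice \<and> norm x \<le> B}"
proof -
  let ?A = "real_of_int ` {- \<lceil>B\<rceil>..\<lceil>B\<rceil>}"
  have "finite (vec_lambda ` {f :: 'n \<Rightarrow> real. range f \<subseteq> ?A})"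
    using finite_set_of_finite_funs[of "UNIV :: 'n set" ?A] by (auto simp: image_subset_iff)
  moreover have "x \<in> vec_lambda ` {f :: 'n \<Rightarrow> real. range f \<subseteq> ?A}"
    if x: "x \<in> int_lattice" "norm x \<le> B" for x :: "real ^ 'n"
  proof -
    have "x $ i \<in> ?A" for i
    proof -
      obtain z where z: "x $ i = of_int z" using x(1) by (auto simp: int_lattice_def elim: Ints_cases)
      have "\<bar>x $ i\<bar> \<le> B" using component_le_norm_cart[of x i] x(2) by linarith
      then have "z \<in> {- \<lceil>B\<rceil>..\<lceil>B\<rceil>}" unfolding z by (auto; linarith)
      then show ?thesis using z by blast
    qed
    then have "range (vec_nth x) \<subseteq> ?A" by blast
    then show ?thesis by (intro image_eqI[of _ _ "vec_nth x"]) (auto simp: vec_lambda_eta)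
  qed
  ultimately show ?thesis
    by (elim finite_subset[rotated]) blast
qed

text \<open>The condition under the \<open>LEAST\<close> in \<open>log_min\<close>, word for word,
  so that it folds.\<close>

definition attains :: "real ^ 'n::finite \<Rightarrow> nat \<Rightarrow> real \<Rightarrow> real \<Rightarrow> bool" where
  "attains u j q L \<longleftrightarrow> 0 \<le> L \<and>
     (\<exists>S. S \<subseteq> (\<lambda>x. exp L *\<^sub>R x) ` body u q \<inter> int_lattice \<and>
          finite S \<and> card S = j \<and> independent S)"

lemma attains_iff:
  "attains u j q L \<longleftrightarrow> 0 \<le> L \<and>
     (\<exists>S \<subseteq> int_lattice. finite S \<and> card S = j \<and> independent S \<and>
        (\<forall>x\<in>S. norm x \<le> exp L \<and> \<bar>x \<bullet> u\<bar> \<le> exp (L - q)))"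
proof -
  have "S \<subseteq> (\<lambda>x. exp L *\<^sub>R x) ` body u q \<inter> int_lattice \<longleftrightarrow>
      S \<subseteq> int_lattice \<and> (\<forall>x\<in>S. norm x \<le> exp L \<and> \<bar>x \<bullet> u\<bar> \<le> exp (L - q))" for S
    by (simp only: subset_iff Int_iff mem_dilate_body) blast
  then show ?thesis
    unfolding attains_def by (simp only: conj_ac)
qed

text \<open>\<open>LEAST\<close> over the reals says something only if the infimum is attained. Near
  the infimum only finitely many sets of lattice points compete, and a set that fails at the infimum
  still fails slightly above it.\<close>

lemma log_min:
  fixes u :: "real ^ 'n::finite"
  assumes "attains u j q L0"
  shows attains_log_min: "attains u j q (log_min u j q)" and log_min_le: "log_min u j q \<le> L0"
proof -
  define A where "A = {L. attains u j q L}"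
  define m where "m = Inf A"
  define fits where
    "fits L S \<longleftrightarrow> (\<forall>x\<in>S. norm x \<le> exp L \<and> \<bar>x \<bullet> u\<bar> \<le> exp (L - q))" for L and S :: "(real ^ 'n) set"
  define C where
    "C = {S :: (real ^ 'n) set. S \<subseteq> {x \<in> int_lattice. norm x \<le> exp (m + 1)} \<and> card S = j \<and> independent S}"
  have bdd: "bdd_below A" by (rule bdd_belowI[of _ 0]) (simp add: A_def attains_def)
  have ne: "A \<noteq> {}" using assms by (auto simp: A_def)
  have m_le: "m \<le> L" if "attains u j q L" for L
    unfolding m_def using bdd that by (intro cInf_lower) (auto simp: A_def)
  have "0 \<le> m" unfolding m_def using ne by (intro cInf_greatest) (auto simp: A_def attains_def)
  have fin: "finite C"
    unfolding C_def
    by (rule finite_subset[of _ "Pow {x \<in> int_lattice. norm x \<le> exp (m + 1)}"])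
       (auto simp: finite_int_lattice_ball)
  have near: "\<exists>S\<in>C. fits L S" if L: "m < L" "L \<le> m + 1" for L
  proof -
    obtain L' where L': "L' \<in> A" "L' < L"
      using cInf_lessD[OF ne, of L] L by (auto simp: m_def)
    then obtain S where S: "S \<subseteq> int_lattice" "card S = j" "independent S"
      "\<And>x. x \<in> S \<Longrightarrow> norm x \<le> exp L' \<and> \<bar>x \<bullet> u\<bar> \<le> exp (L' - q)"
      by (auto simp: A_def attains_iff)
    have mono: "exp L' \<le> exp L" "exp (L' - q) \<le> exp (L - q)" "exp L \<le> exp (m + 1)"
      using L' L by auto
    have "norm x \<le> exp L \<and> norm x \<le> exp (m + 1) \<and> \<bar>x \<bullet> u\<bar> \<le> exp (L - q)" if "x \<in> S" for x
      using S(4)[OF that] mono by linarith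
    then have "S \<in> C" "fits L S" using S(1-3) by (auto simp: C_def fits_def)
    then show ?thesis by blast
  qed
  have "\<exists>S\<in>C. fits m S"
  proof (rule ccontr)
    assume "\<not> ?thesis"
    then have bad: "\<not> fits m S" if "S \<in> C" for S using that by blast
    have "\<exists>L>m. \<not> fits L S" if S: "S \<in> C" for S
    proof -
      obtain x where x: "x \<in> S" "exp m < norm x \<or> exp (m - q) < \<bar>x \<bullet> u\<bar>"
        using bad[OF S] by (auto simp: fits_def not_le)
      have room: "\<exists>L>m. exp (L - r) < t" if t: "exp (m - r) < t" for t r :: real
      proof -
        have "0 < t" using t exp_gt_zero less_trans by blast
        then have ln: "exp (ln t) = t" by simp
        then have "m - r < ln t" using t exp_less_cancel_iff by metis
        then have "m < (m + (ln t + r)) / 2" "(m + (ln t + r)) / 2 - r < ln t"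
          by (simp_all add: field_simps)
        then show ?thesis using ln exp_less_cancel_iff by metis
      qed
      show ?thesis
        using x room[of 0 "norm x"] room[of q "\<bar>x \<bullet> u\<bar>"] by (fastforce simp: fits_def not_le)
    qed
    then obtain f where f: "\<And>S. S \<in> C \<Longrightarrow> m < f S \<and> \<not> fits (f S) S" by metis
    \<comment> \<open>Finitely many failure points, so the least of them still exceeds
      \<open>m\<close>; yet some candidate fits at \<open>L\<close>.\<close>
    define L where "L = Min (insert (m + 1) (f ` C))"
    have "m < L" "L \<le> m + 1" using fin f by (auto simp: L_def)
    from near[OF this] obtain S where S: "S \<in> C" "fits L S" by blast
    have "L \<le> f S" using fin S by (auto simp: L_def)
    then have "exp L \<le> exp (f S)" "exp (L - q) \<le> exp (f S - q)" by simp_all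
    then have "fits (f S) S"
      using S(2) unfolding fits_def by (metis order_trans)
    then show False using f[OF S(1)] by blast
  qed
  then have att: "attains u j q m"
    using \<open>0 \<le> m\<close> independent_imp_finite by (auto simp: attains_iff C_def fits_def)
  then have "log_min u j q = m"
    unfolding log_min_def attains_def[symmetric] by (intro Least_equality m_le)
  then show "attains u j q (log_min u j q)" "log_min u j q \<le> L0"
    using att m_le[OF assms] by simp_all
qed

lemma det_nonzero_iff_independent:
  fixes Y :: "'n::finite \<Rightarrow> real ^ 'n"
  shows "det (\<chi> m. Y m) \<noteq> 0 \<longleftrightarrow> inj Y \<and> independent (range Y)"
proof -
  have rows: "rows (\<chi> m. Y m) = range Y"
    by (auto simp: rows_def row_def vec_nth_inverse)
  show ?thesis
  proof
    assume det: "det (\<chi> m. Y m) \<noteq> 0"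
    have "inj Y"
      using det det_identical_rows[of _ _ "\<chi> m. Y m"] by (auto simp: inj_on_def row_def)
    moreover have "\<not> vec.dependent (range Y)"
      using det det_dependent_rows[of "\<chi> m. Y m"] by (auto simp: rows)
    ultimately show "inj Y \<and> independent (range Y)"
      by (simp add: dependent_vec_eq)
  next
    assume Y: "inj Y \<and> independent (range Y)"
    then have "dim (range Y) = CARD('n)"
      by (simp add: dim_eq_card_independent card_image)
    then show "det (\<chi> m. Y m) \<noteq> 0"
      by (simp add: det_eq_0_rank row_rank_def rows)
  qed
qed

text \<open>The sets realising different minima are unrelated, so independent vectors are picked
  greedily: the set for \<open>Suc k\<close> has too many independent elements to lie in the span of
  the first \<open>k\<close> choices. Then \<open>minima_sum_ge\<close> applies to the
  result.\<close>

lemma sum_log_min_ge: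
  fixes u :: "real ^ 'n::finite"
  assumes u: "norm u = 1" and att: "\<And>j. j \<in> {1..CARD('n)} \<Longrightarrow> \<exists>L. attains u j q L"
  shows "q - real CARD('n) * (ln 2 / 2) \<le> (\<Sum>j\<in>{1..CARD('n)}. log_min u j q)"
proof -
  define fits where
    "fits j x \<longleftrightarrow> x \<in> int_lattice \<and> norm x \<le> exp (log_min u j q) \<and>
      \<bar>x \<bullet> u\<bar> \<le> exp (log_min u j q - q)" for j and x :: "real ^ 'n"
  have sets: "\<exists>S. finite S \<and> card S = j \<and> independent S \<and> (\<forall>x\<in>S. fits j x)"
    if j: "j \<in> {1..CARD('n)}" for j
  proof -
    obtain L where "attains u j q L" using att[OF j] ..
    from attains_log_min[OF this] show ?thesis
      unfolding attains_iff fits_def by blast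
  qed
  have greedy: "\<exists>y. inj_on y {1..k} \<and> independent (y ` {1..k}) \<and> (\<forall>j\<in>{1..k}. fits j (y j))"
    if "k \<le> CARD('n)" for k
    using that
  proof (induction k)
    case (Suc k)
    then obtain y where y: "inj_on y {1..k}" "independent (y ` {1..k})" "\<forall>j\<in>{1..k}. fits j (y j)"
      by auto
    obtain S where S: "finite S" "card S = Suc k" "independent S" "\<forall>x\<in>S. fits (Suc k) x"
      using sets[of "Suc k"] Suc.prems by auto
    have "\<not> S \<subseteq> span (y ` {1..k})"
      using independent_span_bound[of "y ` {1..k}" S] S card_image_le[of "{1..k}" y] by auto
    then obtain x where x: "x \<in> S" "x \<notin> span (y ` {1..k})" by blast
    define y' where "y' = y(Suc k := x)"
    have im: "y' ` {1..k} = y ` {1..k}" by (auto simp: y'_def)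
    have new: "x \<notin> y ` {1..k}" using x(2) span_base by metis
    have Suc_k: "{1..Suc k} = insert (Suc k) {1..k}" by auto
    have "inj_on y' {1..k} \<longleftrightarrow> inj_on y {1..k}"
      by (rule inj_on_cong) (simp add: y'_def)
    with y(1) have "inj_on y' {1..k}" by blast
    then have "inj_on y' {1..Suc k}"
      using new im unfolding Suc_k inj_on_insert by (simp add: y'_def)
    moreover have "y' ` {1..Suc k} = insert x (y ` {1..k})"
      unfolding Suc_k image_insert im by (simp add: y'_def)
    then have "independent (y' ` {1..Suc k})"
      using independent_insertI[OF x(2) y(2)] by simp
    moreover have "\<forall>j\<in>{1..Suc k}. fits j (y' j)"
      using y(3) S(4) x(1) by (auto simp: y'_def)
    ultimately show ?case by blast
  qed (auto simp: independent_empty)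
  then obtain y where y: "inj_on y {1..CARD('n)}" "independent (y ` {1..CARD('n)})"
    "\<forall>j\<in>{1..CARD('n)}. fits j (y j)" by blast
  obtain h :: "'n \<Rightarrow> nat" where h: "bij_betw h UNIV {1..CARD('n)}"
    using finite_same_card_bij[of "UNIV :: 'n set" "{1..CARD('n)}"] by auto
  have h_in: "h m \<in> {1..CARD('n)}" for m using h by (auto simp: bij_betw_def)
  have "inj (\<lambda>m. y (h m))"
  proof (rule injI)
    fix m m' assume "y (h m) = y (h m')"
    then have "h m = h m'" using y(1) h_in by (meson inj_onD)
    then show "m = m'" using bij_betw_imp_inj_on[OF h] by (meson injD)
  qed
  moreover have "range (\<lambda>m. y (h m)) = y ` {1..CARD('n)}"
    using h unfolding bij_betw_def by (metis image_image)
  ultimately have "det (\<chi> m. y (h m)) \<noteq> 0"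
    unfolding det_nonzero_iff_independent using y(2) by simp
  then have "q - real CARD('n) * (ln 2 / 2) \<le> (\<Sum>m\<in>UNIV. log_min u (h m) q)"
    using y(3) h_in by (intro minima_sum_ge[OF u, of "\<lambda>m. y (h m)"]) (auto simp: fits_def)
  also have "\<dots> = (\<Sum>j\<in>{1..CARD('n)}. log_min u j q)"
    by (rule sum.reindex_bij_betw[OF h])
  finally show ?thesis .
qed

text \<open>Formulated with multisets because the moving coordinate may coincide with another
  one.\<close>

lemma card_le_nth_sorted:
  fixes p :: "'n::finite \<Rightarrow> real"
  assumes "sorted xs" "mset xs = image_mset p (mset_set UNIV)" "i < length xs"
  shows "Suc i \<le> card {m. p m \<le> xs ! i}"
proof -
  have "card {m. p m \<le> xs ! i} = size (filter_mset (\<lambda>x. x \<le> xs ! i) (image_mset p (mset_set UNIV)))"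
    by (simp add: filter_mset_image_mset filter_mset_mset_set)
  also have "\<dots> = length (filter (\<lambda>x. x \<le> xs ! i) xs)"
    unfolding assms(2)[symmetric] mset_filter[symmetric] by (rule size_mset)
  also have "\<dots> \<ge> length (filter (\<lambda>x. x \<le> xs ! i) (take (Suc i) xs))"
    by (metis append_take_drop_id filter_append le_add1 length_append)
  also have "filter (\<lambda>x. x \<le> xs ! i) (take (Suc i) xs) = take (Suc i) xs"
    using assms(1,3) by (auto simp: in_set_conv_nth intro!: filter_True sorted_nth_mono)
  finally show ?thesis using assms(3) by simp
qed

text \<open>The upper bounds come from the given lattice points, and the sum of the minima being
  nearly \<open>q\<close> turns them into lower bounds.\<close>

lemma log_minima_near:
  fixes u :: "real ^ 'n::finite" and X :: "'n \<Rightarrow> real ^ 'n" and p :: "'n \<Rightarrow> real"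
  assumes u: "norm u = 1" and X: "\<And>m. X m \<in> int_lattice" "det (\<chi> m. X m) \<noteq> 0"
    and p: "\<And>m. norm (X m) \<le> exp (p m + C)" "\<And>m. \<bar>X m \<bullet> u\<bar> \<le> exp (p m + C - q)"
      "\<And>m. 0 \<le> p m" "(\<Sum>m\<in>UNIV. p m) = q"
    and xs: "sorted xs" "mset xs = image_mset p (mset_set UNIV)"
    and C: "0 \<le> C"
  shows "dist_inf CARD('n) xs (log_minima u q) \<le> real CARD('n) * (C + ln 2 / 2)"
proof -
  let ?n = "CARD('n)"
  have len: "length xs = ?n"
    using arg_cong[OF xs(2), of size] by simp
  have X_indep: "inj X" "independent (range X)"
    using X(2) det_nonzero_iff_independent by blast+
  have att: "attains u j q (coord xs j + C)" if j: "j \<in> {1..?n}" for j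
  proof -
    have i: "j - 1 < length xs" using j len by auto
    have "j \<le> card {m. p m \<le> coord xs j}"
      using card_le_nth_sorted[OF xs i] j by (simp add: coord_def)
    then obtain J where J: "J \<subseteq> {m. p m \<le> coord xs j}" "card J = j"
      using obtain_subset_with_card_n by metis
    have "J \<noteq> {}" using J j by auto
    then have "0 \<le> coord xs j" using J(1) p(3) order_trans by blast
    moreover have "card (X ` J) = j"
      using J X_indep(1) by (metis card_image inj_on_subset subset_UNIV)
    moreover have "independent (X ` J)"
      using X_indep(2) by (rule independent_mono) auto
    moreover have "norm x \<le> exp (coord xs j + C) \<and> \<bar>x \<bullet> u\<bar> \<le> exp (coord xs j + C - q)"
      if x: "x \<in> X ` J" for x
    proof -
      obtain m where "x = X m" "p m \<le> coord xs j" using x J(1) by auto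
      then show ?thesis
        using p(1,2)[of m] by (smt (verit) exp_le_cancel_iff)
    qed
    ultimately show ?thesis
      unfolding attains_iff using C X(1) by (intro conjI exI[of _ "X ` J"]) auto
  qed
  have upper: "log_min u j q \<le> coord xs j + C" if "j \<in> {1..?n}" for j
    by (rule log_min_le[OF att[OF that]])
  have sum_xs: "(\<Sum>j\<in>{1..?n}. coord xs j) = q"
  proof -
    have "(\<Sum>j\<in>{1..?n}. coord xs j) = (\<Sum>i<?n. xs ! i)"
      by (rule sum.reindex_bij_witness[of _ Suc "\<lambda>j. j - 1"]) (auto simp: coord_def)
    also have "\<dots> = sum_mset (mset xs)"
      by (simp add: sum_mset_sum_list sum_list_sum_nth len atLeast0LessThan)
    finally show ?thesis using p(4) by (simp add: xs(2) sum_unfold_sum_mset)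
  qed
  have lower: "q - real ?n * (ln 2 / 2) \<le> (\<Sum>j\<in>{1..?n}. log_min u j q)"
    using att by (intro sum_log_min_ge[OF u]) blast
  have near: "\<bar>coord xs j - log_min u j q\<bar> \<le> real ?n * (C + ln 2 / 2)" if j: "j \<in> {1..?n}" for j
  proof -
    have "(\<Sum>i\<in>{1..?n} - {j}. log_min u i q) \<le> (\<Sum>i\<in>{1..?n} - {j}. coord xs i + C)"
      by (intro sum_mono upper) auto
    also have "\<dots> = q - coord xs j + (real ?n - 1) * C"
      using sum_xs sum.remove[OF _ j, of "coord xs"] j
      by (simp add: sum.distrib of_nat_diff del: atLeastAtMost_iff)
    \<comment> \<open>One minimum can fall short only by what the other \<open>n - 1\<close> exceed
      plus the loss in the sum; hence the factor \<open>n\<close> in the final bound.\<close>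
    finally have "coord xs j - log_min u j q \<le> (real ?n - 1) * C + real ?n * (ln 2 / 2)"
      using lower sum.remove[OF finite_atLeastAtMost j, of "\<lambda>j. log_min u j q"] by linarith
    moreover have "1 * C \<le> real ?n * C"
      using C by (intro mult_right_mono) (auto simp: Suc_leI)
    moreover have "0 \<le> real ?n * (ln 2 / 2)" by simp
    ultimately show ?thesis
      using upper[OF j] C unfolding abs_le_iff distrib_left left_diff_distrib by linarith
  qed
  have "coord (log_minima u q) j = log_min u j q" if "j \<in> {1..?n}" for j
  proof -
    have "j - 1 < ?n" "1 + (j - 1) = j" using that by auto
    then show ?thesis by (simp add: coord_def log_minima_def nth_upt del: upt_Suc)
  qed
  then show ?thesis
    unfolding dist_inf_def using near by (intro Max.boundedI) (auto simp: Suc_leI)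
qed

section \<open>Mesh arithmetic, list coordinates and a convergence criterion\<close>

text \<open>The induction starts at 4, the first place where the cube at most doubles from
  \<open>n\<close> to \<open>n + 1\<close> (125 against 128); there the cubic bound is an
  equality.\<close>

lemma cube_le_two_power: "n ^ 3 \<le> 4 * 2 ^ n" "n\<^sup>2 \<le> 2 * 2 ^ n" for n :: nat
proof -
  have *: "n ^ 3 \<le> 4 * 2 ^ n \<and> n\<^sup>2 \<le> 2 * 2 ^ n" if "4 \<le> n"
    using that
  proof (induction n rule: nat_induct_at_least)
    case (Suc n)
    have "4 * (n * n) \<le> n * (n * n)" "4 * n \<le> n * n"
      using Suc.hyps by (simp_all only: mult_le_mono1)
    moreover have "(Suc n) ^ 3 = n * (n * n) + 3 * (n * n) + 3 * n + 1"
      "(Suc n)\<^sup>2 = n * n + 2 * n + 1"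
      by (simp_all add: power2_eq_square power3_eq_cube algebra_simps)
    moreover have "n ^ 3 = n * (n * n)" "n\<^sup>2 = n * n"
      by (simp_all add: power2_eq_square power3_eq_cube)
    ultimately have "(Suc n) ^ 3 \<le> 2 * n ^ 3" "(Suc n)\<^sup>2 \<le> 2 * n\<^sup>2"
      using Suc.hyps by linarith+
    then show ?case using Suc.IH by simp
  qed simp
  have "n \<in> {0, 1, 2, 3} \<or> 4 \<le> n" by auto
  then show "n ^ 3 \<le> 4 * 2 ^ n" "n\<^sup>2 \<le> 2 * 2 ^ n"
    using * by (auto simp: numeral_eq_Suc)
qed

text \<open>The cubic and quadratic bounds add up to \<open>64 * 2 ^ n\<close>;
  \<open>(n + 3) * ln 2\<close> supplies \<open>8 * 2 ^ n\<close>, and \<open>exp 4\<close> more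
  than the missing factor 8.\<close>

lemma mesh_bound:
  assumes "4 + (real n + 3) * ln 2 \<le> \<delta>"
  shows "8 * real n ^ 3 + 16 * (real n)\<^sup>2 \<le> exp \<delta>"
proof -
  have "exp (4 + (real n + 3) * ln 2) = exp 4 * (8 * 2 ^ n)"
    using exp_of_nat_mult[of "n + 3" "ln 2 :: real"] by (simp add: exp_add power_add)
  moreover have "(2::real) ^ 4 \<le> exp 1 ^ 4"
    using exp_ge_add_one_self[of 1] by (intro power_mono) auto
  then have "16 \<le> exp (4::real)" by (simp flip: exp_of_nat_mult)
  then have "8 * (8 * 2 ^ n) \<le> exp 4 * (8 * 2 ^ n :: real)"
    by (intro mult_right_mono) auto
  moreover have "exp (4 + (real n + 3) * ln 2) \<le> exp \<delta>" using assms by simp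
  moreover have "real (n ^ 3) \<le> real (4 * 2 ^ n)" "real (n\<^sup>2) \<le> real (2 * 2 ^ n)"
    by (simp_all only: of_nat_le_iff cube_le_two_power)
  then have "real n ^ 3 \<le> 4 * 2 ^ n" "(real n)\<^sup>2 \<le> 2 * 2 ^ n" by simp_all
  ultimately show ?thesis by linarith
qed

lemma del_coord_props:
  assumes "1 \<le> j" "j \<le> length x" "distinct x"
  shows set_del_coord: "set (del_coord x j) = set x - {coord x j}"
    and coord_in_set: "coord x j \<in> set x"
proof -
  have x: "x = take (j - 1) x @ coord x j # drop j x"
    using id_take_nth_drop[of "j - 1" x] assms by (simp add: coord_def)
  then have "set x = insert (coord x j) (set (del_coord x j))"
    unfolding del_coord_def by (metis Un_insert_right list.simps(15) set_append)
  moreover have "coord x j \<notin> set (del_coord x j)"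
    using assms(3) x unfolding del_coord_def
    by (metis Un_iff distinct.simps(2) distinct_append disjoint_insert(1) list.simps(15) set_append)
  ultimately show "set (del_coord x j) = set x - {coord x j}" "coord x j \<in> set x" by auto
qed

lemma multiple_less_imp_gap:
  assumes "0 < \<delta>" "x = real i * \<delta>" "y = real j * \<delta>" "x < y"
  shows "x + \<delta> \<le> y"
proof -
  have "i < j" using assms by simp
  then have "real i + 1 \<le> real j" by linarith
  then have "(real i + 1) * \<delta> \<le> real j * \<delta>" using assms(1) by (intro mult_right_mono) auto
  then show ?thesis using assms by (simp add: algebra_simps)
qed

text \<open>\<open>g i\<close> stands for a bound on the length of the path still to come, which
  makes the distance to the limit explicit.\<close>

lemma Cauchy_telescope:
  fixes u :: "nat \<Rightarrow> 'a::banach" and g :: "nat \<Rightarrow> real"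
  assumes step: "\<And>i. norm (u (Suc i) - u i) \<le> g i - g (Suc i)" and g: "\<And>i. 0 \<le> g i"
  obtains v where "u \<longlonglongrightarrow> v" "\<And>i. norm (v - u i) \<le> g i"
proof -
  have diff: "norm (u m - u i) \<le> g i - g m" if "i \<le> m" for i m
    using that
  proof (induction m rule: dec_induct)
    case (step m)
    then show ?case
      using norm_triangle_ineq[of "u (Suc m) - u m" "u m - u i"] assms(1)[of m] by simp
  qed simp
  have "decseq g"
  proof (rule decseq_SucI)
    show "g (Suc i) \<le> g i" for i
      using step[of i] norm_ge_zero[of "u (Suc i) - u i"] by linarith
  qed
  then obtain L where "g \<longlonglongrightarrow> L"
    using decseq_convergent[of g 0] g by blast
  then have "Cauchy g" by (rule LIMSEQ_imp_Cauchy)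
  have "Cauchy u"
  proof (rule CauchyI)
    fix e :: real assume "0 < e"
    then obtain M where M: "\<And>m n. M \<le> m \<Longrightarrow> M \<le> n \<Longrightarrow> norm (g m - g n) < e"
      using \<open>Cauchy g\<close> unfolding Cauchy_iff by blast
    have "norm (u m - u n) < e" if "M \<le> m" "M \<le> n" for m n
    proof (cases "m \<le> n")
      case True
      then show ?thesis using diff[OF True] M[OF that] by (simp add: norm_minus_commute)
    next
      case False
      then show ?thesis using diff[of n m] M[OF that] by simp
    qed
    then show "\<exists>M. \<forall>m\<ge>M. \<forall>n\<ge>M. norm (u m - u n) < e" by blast
  qed
  then obtain v where v: "u \<longlonglongrightarrow> v" using Cauchy_convergent convergent_def by blast
  have "norm (v - u i) \<le> g i" for i
  proof (rule tendsto_upperbound)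
    show "(\<lambda>m. norm (u m - u i)) \<longlonglongrightarrow> norm (v - u i)" by (intro tendsto_intros v)
    show "\<forall>\<^sub>F m in sequentially. norm (u m - u i) \<le> g i"
      using eventually_ge_at_top[of i] by eventually_elim (use diff g in \<open>smt (verit)\<close>)
  qed simp
  with v show thesis by (rule that)
qed

section \<open>Following a canvas\<close>

text \<open>The parameter \<open>ty\<close> ties the dimension to the locale, as the canvas data do
  not mention the type \<open>'n\<close>.\<close>

locale mesh_canvas =
  fixes \<delta> :: real and s :: enat and a :: "nat \<Rightarrow> real list" and k l :: "nat \<Rightarrow> nat"
    and ty :: "'n::finite itself"
  assumes card_ge: "2 \<le> CARD('n)"
    and mesh: "4 + (real CARD('n) + 3) * ln 2 \<le> \<delta>"
    and canvas: "canvas CARD('n) \<delta> s a k l"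
begin

lemma \<delta>_ge: "1 \<le> \<delta>"
proof -
  have "0 \<le> (real CARD('n) + 3) * ln 2" by simp
  then show ?thesis using mesh by linarith
qed

lemma zero_less_s: "enat 0 < s"
proof -
  have "1 \<le> s" using canvas unfolding canvas_def by blast
  then have "0 < s" by (rule less_le_trans[rotated]) simp
  then show ?thesis by (simp add: zero_enat_def)
qed

lemma point:
  assumes "enat i < s"
  shows length_a: "length (a i) = CARD('n)" and sorted_a: "sorted (a i)"
    and distinct_a: "distinct (a i)" and strict_a: "sorted_wrt (<) (a i)"
    and multiple_a: "x \<in> set (a i) \<Longrightarrow> \<exists>m::nat. 0 < m \<and> x = real m * \<delta>"
proof -
  have "a i \<in> Delta CARD('n) \<and> sorted_wrt (<) (a i) \<and>
      (\<forall>x\<in>set (a i). \<exists>m::nat. 0 < m \<and> x = real m * \<delta>)"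
    using assms canvas unfolding canvas_def by blast
  then show "length (a i) = CARD('n)" "sorted (a i)" "distinct (a i)" "sorted_wrt (<) (a i)"
    "x \<in> set (a i) \<Longrightarrow> \<exists>m::nat. 0 < m \<and> x = real m * \<delta>"
    using strict_sorted_iff[of "a i"] unfolding Delta_def by blast+
qed

lemma k_range:
  assumes "enat i < s"
  shows "1 \<le> k i \<and> k i \<le> CARD('n)"
proof (cases "i = 0")
  case True
  have "1 \<le> k 0 \<and> k 0 \<le> l 0 \<and> l 0 = CARD('n)"
    using canvas unfolding canvas_def by blast
  then show ?thesis using True by simp
next
  case False
  then have "1 \<le> i" by simp
  then have "1 \<le> k i \<and> k i < l i \<and> l i \<le> CARD('n)"
    using canvas assms unfolding canvas_def by blast
  then show ?thesis by linarith
qed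

lemma a_ge: "enat i < s \<Longrightarrow> x \<in> set (a i) \<Longrightarrow> \<delta> \<le> x"
proof -
  assume i: "enat i < s" and x: "x \<in> set (a i)"
  obtain m :: nat where m: "0 < m" "x = real m * \<delta>" using multiple_a[OF i x] by blast
  then have "1 * \<delta> \<le> real m * \<delta>" using \<delta>_ge by (intro mult_right_mono) auto
  then show "\<delta> \<le> x" using m by simp
qed

lemma switch_eq: "enat i < s \<Longrightarrow> switch a i = \<Sum>(set (a i))"
  using sum_list_distinct_conv_sum_set[OF distinct_a, of i "\<lambda>x. x"] by (simp add: switch_def)

text \<open>Seen as sets, consecutive points differ in a single element, which removes the shift of
  positions. The gap over the removed coordinate holds because \<open>k i\<close> does not exceed
  \<open>l (Suc i)\<close> and the tuple is sorted.\<close>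

lemma transition:
  assumes i: "enat (Suc i) < s"
  defines "c \<equiv> coord (a (Suc i)) (l (Suc i))"
  shows "set (a i) - {coord (a i) (k i)} = set (a (Suc i)) - {c}"
    and "c \<in> set (a (Suc i))" "coord (a i) (k i) + \<delta> \<le> c" "coord (a (Suc i)) (k (Suc i)) < c"
proof -
  have i': "enat i < s" using i by (metis Suc_ile_eq order_less_imp_le)
  have C: "k i \<le> l (i + 1)" "coord (a i) (l (i + 1)) + \<delta> \<le> coord (a (i + 1)) (l (i + 1))"
    "del_coord (a i) (k i) = del_coord (a (i + 1)) (l (i + 1))"
    "1 \<le> k (i + 1)" "k (i + 1) < l (i + 1)" "l (i + 1) \<le> CARD('n)"
  proof -
    have i1: "enat (i + 1) < s" "1 \<le> i + 1" using i by simp_all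
    show "k i \<le> l (i + 1)" "coord (a i) (l (i + 1)) + \<delta> \<le> coord (a (i + 1)) (l (i + 1))"
      "del_coord (a i) (k i) = del_coord (a (i + 1)) (l (i + 1))"
      using canvas i1(1) unfolding canvas_def by blast+
    show "1 \<le> k (i + 1)" "k (i + 1) < l (i + 1)" "l (i + 1) \<le> CARD('n)"
      using canvas i1 unfolding canvas_def by blast+
  qed
  have l: "1 \<le> l (Suc i)" "l (Suc i) \<le> length (a (Suc i))" "l (Suc i) \<le> length (a i)"
    using C length_a[OF i] length_a[OF i'] by auto
  have ki: "1 \<le> k i" "k i \<le> length (a i)"
    using k_range[OF i'] length_a[OF i'] by auto
  show "set (a i) - {coord (a i) (k i)} = set (a (Suc i)) - {c}"
    using set_del_coord[OF ki distinct_a[OF i']] set_del_coord[OF l(1,2) distinct_a[OF i]] C(3)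
    by (simp add: c_def)
  show "c \<in> set (a (Suc i))"
    unfolding c_def by (rule coord_in_set[OF l(1,2) distinct_a[OF i]])
  have "coord (a i) (k i) \<le> coord (a i) (l (Suc i))"
    unfolding coord_def using C(1) l ki by (intro sorted_nth_mono[OF sorted_a[OF i']]) auto
  then show "coord (a i) (k i) + \<delta> \<le> c" using C(2) by (simp add: c_def)
  show "coord (a (Suc i)) (k (Suc i)) < c"
    unfolding c_def coord_def using C l
    by (intro sorted_wrt_nth_less[OF strict_a[OF i]]) auto
qed

lemma switch_Suc:
  assumes "enat (Suc i) < s"
  shows "switch a i + \<delta> \<le> switch a (Suc i)"
proof -
  have i': "enat i < s" using assms by (metis Suc_ile_eq order_less_imp_le)
  have "coord (a i) (k i) \<in> set (a i)"
    using k_range[OF i'] length_a[OF i'] distinct_a[OF i'] by (intro coord_in_set) auto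
  then have "switch a i = coord (a i) (k i) + \<Sum>(set (a i) - {coord (a i) (k i)})"
    using switch_eq[OF i'] sum.remove[of "set (a i)" "coord (a i) (k i)" "\<lambda>x. x"] by simp
  moreover have "switch a (Suc i) = coord (a (Suc i)) (l (Suc i)) +
      \<Sum>(set (a (Suc i)) - {coord (a (Suc i)) (l (Suc i))})"
    using switch_eq[OF assms] transition(2)[OF assms]
      sum.remove[of "set (a (Suc i))" "coord (a (Suc i)) (l (Suc i))" "\<lambda>x. x"] by simp
  ultimately show ?thesis
    using transition(3)[OF assms] unfolding transition(1)[OF assms] by linarith
qed

text \<open>Beyond the end of a finite canvas only the unit normal is recorded, so finite and
  infinite canvases both yield an infinite sequence of normals, eventually constant in the finite
  case.\<close>

definition state :: "nat \<Rightarrow> ('n \<Rightarrow> real ^ 'n) \<times> ('n \<Rightarrow> real) \<times> 'n \<times> (real ^ 'n) \<Rightarrow> bool" where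
  "state i = (\<lambda>(X, b, \<kappa>, u). norm u = 1 \<and>
     (enat i < s \<longrightarrow> admissible \<delta> X b \<kappa> \<and> bij_betw b UNIV (set (a i)) \<and>
        b \<kappa> = coord (a i) (k i) \<and> (\<forall>m. m \<noteq> \<kappa> \<longrightarrow> u \<bullet> X m = 0)))"

lemma exp_mesh: "8 * real CARD('n) ^ 3 + 16 * (real CARD('n))\<^sup>2 \<le> exp \<delta>"
  by (rule mesh_bound[OF mesh])

lemma label_of:
  assumes "enat i < s" "bij_betw b UNIV (set (a i))"
  obtains \<kappa> :: 'n where "b \<kappa> = coord (a i) (k i)"
proof -
  have "coord (a i) (k i) \<in> set (a i)"
    using k_range[OF assms(1)] length_a[OF assms(1)] distinct_a[OF assms(1)]
    by (intro coord_in_set) auto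
  then have "coord (a i) (k i) \<in> range b" using assms(2) by (simp add: bij_betw_def)
  then obtain \<kappa> where "coord (a i) (k i) = b \<kappa>" by blast
  then show thesis by (intro that) simp
qed

lemma start_state: "\<exists>st. state 0 st"
proof -
  note s = zero_less_s
  obtain b :: "'n \<Rightarrow> real" where b: "bij_betw b UNIV (set (a 0))"
    using finite_same_card_bij[of "UNIV :: 'n set" "set (a 0)"] length_a[OF s] distinct_a[OF s]
    by (auto simp: distinct_card)
  obtain \<kappa> where \<kappa>: "b \<kappa> = coord (a 0) (k 0)" by (rule label_of[OF s b])
  have "inj b" "\<delta> \<le> b m" for m
    using b a_ge[OF s, of "b m"] by (auto simp: bij_betw_def)
  then obtain X u where "admissible \<delta> X b \<kappa>" "norm u = 1" "\<And>m. m \<noteq> \<kappa> \<Longrightarrow> u \<bullet> X m = 0"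
    using admissible_start[OF exp_mesh card_ge, of b \<kappa>] by metis
  then have "state 0 (X, b, \<kappa>, u)" using b \<kappa> by (simp add: state_def)
  then show ?thesis ..
qed

definition next_normal :: "nat \<Rightarrow> real ^ 'n \<Rightarrow> real ^ 'n \<Rightarrow> bool" where
  "next_normal i u u' \<longleftrightarrow>
     (if enat (Suc i) < s then norm (u' - u) \<le> 8 * exp (- switch a (Suc i)) else u' = u)"

lemma next_state:
  assumes st: "state i (X, b, \<kappa>, u)"
  shows "\<exists>X' b1 \<kappa>' u'. state (Suc i) (X', b1, \<kappa>', u') \<and> next_normal i u u'"
proof (cases "enat (Suc i) < s")
  case False
  then have "state (Suc i) (X, b, \<kappa>, u)" "next_normal i u u"
    using st by (auto simp: state_def next_normal_def)
  then show ?thesis by blast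
next
  case True
  then have i: "enat i < s" by (metis Suc_ile_eq order_less_imp_le)
  have adm: "admissible \<delta> X b \<kappa>" and b: "bij_betw b UNIV (set (a i))"
    and b\<kappa>: "b \<kappa> = coord (a i) (k i)" and u: "norm u = 1" "\<And>m. m \<noteq> \<kappa> \<Longrightarrow> u \<bullet> X m = 0"
    using st i by (auto simp: state_def)
  define c where "c = coord (a (Suc i)) (l (Suc i))"
  note tr = transition[OF True, folded c_def]
  define b1 where "b1 = b(\<kappa> := c)"
  have range_b: "b ` (- {\<kappa>}) = set (a (Suc i)) - {c}"
  proof -
    have "b ` (- {\<kappa>}) = range b - {b \<kappa>}" using b by (auto simp: bij_betw_def inj_on_def)
    then show ?thesis using b b\<kappa> tr(1) by (simp add: bij_betw_def)
  qed
  have fresh: "b m \<noteq> c" if "m \<noteq> \<kappa>" for m using range_b that by blast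
  have b1: "bij_betw b1 UNIV (set (a (Suc i)))"
    unfolding bij_betw_def
  proof
    show "inj b1" using b fresh by (auto simp: b1_def bij_betw_def inj_on_def)
    have "range b1 = insert c (b ` (- {\<kappa>}))" by (auto simp: b1_def)
    then show "range b1 = set (a (Suc i))" using range_b tr(2) by auto
  qed
  obtain \<kappa>' where \<kappa>': "b1 \<kappa>' = coord (a (Suc i)) (k (Suc i))" by (rule label_of[OF True b1])
  then have \<kappa>'_ne: "\<kappa>' \<noteq> \<kappa>" using tr(4) by (auto simp: b1_def)
  \<comment> \<open>The removed coordinate has its gap from the canvas; any other one below
    \<open>c\<close> is, like \<open>c\<close>, a multiple of \<open>\<delta>\<close>.\<close>
  have gap: "b m + \<delta> \<le> c" if "m = \<kappa> \<or> b m < c" for m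
  proof (cases "m = \<kappa>")
    case True
    then show ?thesis using tr(3) b\<kappa> by simp
  next
    case False
    then have "b m \<in> set (a (Suc i))" using range_b by blast
    then obtain j j' :: nat where "b m = real j * \<delta>" "c = real j' * \<delta>"
      using multiple_a[OF True] tr(2) by metis
    then show ?thesis using multiple_less_imp_gap[of \<delta> "b m" j c j'] \<delta>_ge that False by simp
  qed
  interpret canvas_step \<delta> c X b \<kappa> \<kappa>'
  proof
    show "b \<kappa>' < c" using \<kappa>' \<kappa>'_ne tr(4) by (simp add: b1_def)
  qed (fact exp_mesh card_ge adm gap fresh \<kappa>'_ne)+
  have "\<delta> \<le> b m" for m
    using a_ge[OF i] b by (auto simp: bij_betw_def)
  then have "0 \<le> (\<Sum>m\<in>UNIV. b m)"
    using \<delta>_ge by (intro sum_nonneg) (metis order_trans zero_le_one)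
  then obtain Y where YY: "admissible \<delta> Y b1 \<kappa>'"
    "\<And>u. norm u = 1 \<Longrightarrow> (\<And>m. m \<noteq> \<kappa> \<Longrightarrow> u \<bullet> X m = 0) \<Longrightarrow>
      \<exists>u'. norm u' = 1 \<and> (\<forall>m. m \<noteq> \<kappa>' \<longrightarrow> u' \<bullet> Y m = 0) \<and>
        norm (u' - u) \<le> 8 * exp (- (\<Sum>m\<in>UNIV. b1 m))"
    unfolding b1_def by (rule step) blast
  from YY(1) YY(2)[OF u] have Y: "admissible \<delta> Y b1 \<kappa>'"
    "\<exists>u'. norm u' = 1 \<and> (\<forall>m. m \<noteq> \<kappa>' \<longrightarrow> u' \<bullet> Y m = 0) \<and>
      norm (u' - u) \<le> 8 * exp (- (\<Sum>m\<in>UNIV. b1 m))"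
    by blast+
  have "(\<Sum>m\<in>UNIV. b1 m) = switch a (Suc i)"
    using sum.reindex_bij_betw[OF b1, of "\<lambda>x. x"] by (simp add: switch_eq True)
  with Y b1 \<kappa>' True show ?thesis
    by (auto simp: state_def next_normal_def)
qed

text \<open>As \<open>34 \<le> 2 ^ 6\<close>, the left side per coordinate is at most
  \<open>6.5 * ln 2\<close>; \<open>ln 8\<close> accounts for \<open>3 * ln 2\<close> of it and the
  summand 4 for the rest.\<close>

lemma ln_bound:
  "real CARD('n) * (ln 34 + ln 2 / 2) \<le> real CARD('n) * ln (8 * exp 4 * real CARD('n))"
proof (rule mult_left_mono)
  have "ln 34 \<le> ln ((2::real) ^ 6)" by (subst ln_le_cancel_iff) auto
  also have "\<dots> = 6 * ln 2" by (subst ln_realpow) auto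
  finally have "ln (34::real) \<le> 6 * ln 2" .
  moreover have "ln ((2::real) ^ 3) = 3 * ln 2" by (subst ln_realpow) auto
  then have "ln (8::real) = 3 * ln 2" by simp
  moreover have "ln (2::real) \<le> 1" using ln_le_minus_one[of 2] by simp
  moreover have "0 \<le> ln (real CARD('n))" using card_ge by (intro ln_ge_zero) linarith
  moreover have "ln (8 * exp 4 * real CARD('n)) = ln 8 + 4 + ln (real CARD('n))"
    by (simp add: ln_mult)
  moreover have "0 \<le> ln (2::real)" by simp
  ultimately show "ln 34 + ln 2 / 2 \<le> ln (8 * exp 4 * real CARD('n))" by linarith
qed simp

lemma approximating_vector:
  obtains u :: "real ^ 'n" where "norm u = 1"
    and "\<And>i q. enat i < s \<Longrightarrow> switch a i \<le> q \<Longrightarrow> (enat (i + 1) < s \<longrightarrow> q < switch a (i + 1)) \<Longrightarrow>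
      dist_inf CARD('n) (sort (del_coord (a i) (k i) @ [coord (a i) (k i) + q - switch a i]))
        (log_minima u q) \<le> real CARD('n) * (ln 34 + ln 2 / 2)"
proof -
  have "\<exists>f. \<forall>i. state i (f i) \<and>
      next_normal i (snd (snd (snd (f i)))) (snd (snd (snd (f (Suc i)))))"
  proof (rule dependent_nat_choice)
    show "\<exists>st. state 0 st" by (rule start_state)
    fix st i assume "state i st"
    moreover obtain X b \<kappa> u where "st = (X, b, \<kappa>, u)" by (cases st)
    ultimately show "\<exists>st'. state (Suc i) st' \<and> next_normal i (snd (snd (snd st))) (snd (snd (snd st')))"
      using next_state[of i X b \<kappa> u] by fastforce
  qed
  then obtain f where f: "\<And>i. state i (f i)"
    "\<And>i. next_normal i (snd (snd (snd (f i)))) (snd (snd (snd (f (Suc i)))))" by blast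
  define un where "un i = snd (snd (snd (f i)))" for i
  \<comment> \<open>Bounds all turns after index \<open>i\<close>. Switches are at least 1 apart, so
    the terms \<open>8 * exp (- switch a j)\<close> at least halve and sum to at most twice the
    first one.\<close>
  define g where "g i = (if enat (Suc i) < s then 16 * exp (- switch a (Suc i)) else 0)" for i
  have "norm (un (Suc i) - un i) \<le> g i - g (Suc i)" for i
  proof (cases "enat (Suc i) < s")
    case True
    have "g (Suc i) \<le> 8 * exp (- switch a (Suc i))"
    proof (cases "enat (Suc (Suc i)) < s")
      case True
      have "exp (- switch a (Suc (Suc i))) \<le> exp (- switch a (Suc i) - 1)"
        using switch_Suc[OF True] \<delta>_ge by simp
      also have "\<dots> = exp (- switch a (Suc i)) / exp 1" by (rule exp_diff)
      also have "\<dots> \<le> exp (- switch a (Suc i)) / 2"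
        using exp_ge_add_one_self[of 1] by (intro divide_left_mono) auto
      finally show ?thesis using True by (simp add: g_def)
    qed (simp add: g_def)
    then show ?thesis using f(2)[of i] True by (simp add: next_normal_def un_def g_def)
  next
    case False
    then have "\<not> enat (Suc (Suc i)) < s" by (meson Suc_ile_eq less_imp_le not_less order_trans)
    then show ?thesis using f(2)[of i] False by (simp add: next_normal_def un_def g_def)
  qed
  moreover have "0 \<le> g i" for i by (simp add: g_def)
  ultimately obtain u where u: "un \<longlonglongrightarrow> u" "\<And>i. norm (u - un i) \<le> g i"
    by (rule Cauchy_telescope) blast
  have norm_un: "norm (un i) = 1" for i
    using f(1)[of i] by (simp add: state_def un_def split: prod.splits)
  then have norm_u: "norm u = 1"
    using tendsto_norm[OF u(1)] by (simp add: LIMSEQ_const_iff)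
  show thesis
  proof (rule that[OF norm_u])
    fix i q
    assume i: "enat i < s" and q: "switch a i \<le> q" "enat (i + 1) < s \<longrightarrow> q < switch a (i + 1)"
    obtain X b \<kappa> where fi: "f i = (X, b, \<kappa>, un i)" by (cases "f i") (simp add: un_def)
    have adm: "admissible \<delta> X b \<kappa>" and b: "bij_betw b UNIV (set (a i))"
      and b\<kappa>: "b \<kappa> = coord (a i) (k i)" and ui: "\<And>m. m \<noteq> \<kappa> \<Longrightarrow> un i \<bullet> X m = 0"
      using f(1)[of i] i by (auto simp: state_def fi)
    have sum_b: "(\<Sum>m\<in>UNIV. b m) = switch a i"
      using sum.reindex_bij_betw[OF b, of "\<lambda>x. x"] by (simp add: switch_eq i)
    \<comment> \<open>The values of the system at \<open>q\<close>, by label: only the coordinate of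
      \<open>\<kappa>\<close> moves during the interval.\<close>
    define p where "p = b(\<kappa> := b \<kappa> + q - switch a i)"
    have norm_X: "norm (X m) \<le> 2 * exp (b m)" for m using adm by (simp add: admissible_def)
    \<comment> \<open>Before the next switch, \<open>q\<close> is smaller than it; on a last
      interval \<open>g i\<close> is 0.\<close>
    have gq: "g i \<le> 16 * exp (- q)" using q by (auto simp: g_def)
    have close: "\<bar>X m \<bullet> u\<bar> \<le> \<bar>X m \<bullet> un i\<bar> + 32 * exp (b m - q)" for m
    proof -
      have "\<bar>X m \<bullet> (u - un i)\<bar> \<le> norm (X m) * norm (u - un i)" by (rule Cauchy_Schwarz_ineq2)
      also have "\<dots> \<le> 2 * exp (b m) * (16 * exp (- q))"
        using u(2)[of i] gq by (intro mult_mono norm_X) auto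
      also have "\<dots> = 32 * exp (b m - q)" by (simp add: exp_diff exp_minus field_simps)
      finally show ?thesis unfolding inner_diff_right by linarith
    qed
    \<comment> \<open>34 is 2, from the distance to the \<open>i\<close>-th hyperplane, plus 32,
      from the later turns.\<close>
    have exp_C: "exp (x + ln 34) = 34 * exp x" "exp (x + ln 34 - q) = 34 * exp (x - q)" for x
      by (simp_all add: exp_add exp_diff)
    have bp: "b m \<le> p m" for m using q by (simp add: p_def)
    show "dist_inf CARD('n) (sort (del_coord (a i) (k i) @ [coord (a i) (k i) + q - switch a i]))
        (log_minima u q) \<le> real CARD('n) * (ln 34 + ln 2 / 2)"
    proof (rule log_minima_near[OF norm_u])
      show "X m \<in> int_lattice" for m using adm by (simp add: admissible_def)
      show "det (\<chi> m. X m) \<noteq> 0" using adm by (auto simp: admissible_def)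
      show "norm (X m) \<le> exp (p m + ln 34)" for m
      proof -
        have "exp (b m) \<le> exp (p m)" using bp by simp
        then show ?thesis using norm_X[of m] exp_ge_zero[of "p m"] unfolding exp_C by linarith
      qed
      show "\<bar>X m \<bullet> u\<bar> \<le> exp (p m + ln 34 - q)" for m
      proof -
        \<comment> \<open>Only \<open>X \<kappa>\<close> leaves the hyperplane, and
          \<open>p \<kappa> - q\<close> equals \<open>b \<kappa> - switch a i\<close>, the exponent
          in the covolume bound.\<close>
        have "\<bar>X m \<bullet> un i\<bar> \<le> 2 * exp (p m - q)"
        proof (cases "m = \<kappa>")
          case True
          have "\<bar>un i \<bullet> X \<kappa>\<bar> \<le> norm (un i) * norm (perp (X ` (- {\<kappa>})) (X \<kappa>))"
            using ui by (intro inner_le_norm_perp) auto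
          also have "\<dots> \<le> 2 * exp (b \<kappa> - switch a i)"
            using admissible_covolume[OF adm] by (simp add: norm_un sum_b)
          finally show ?thesis using True by (simp add: p_def inner_commute)
        qed (use ui in \<open>simp add: inner_commute\<close>)
        moreover have "exp (b m - q) \<le> exp (p m - q)" using bp by simp
        ultimately show ?thesis using close[of m] unfolding exp_C by linarith
      qed
      show "0 \<le> p m" for m
      proof -
        have "\<delta> \<le> b m" using a_ge[OF i] b by (auto simp: bij_betw_def)
        then show ?thesis using \<delta>_ge bp[of m] by linarith
      qed
      have "(\<Sum>m\<in>UNIV. p m) = p \<kappa> + (\<Sum>m\<in>UNIV - {\<kappa>}. b m)"
        by (simp add: p_def sum.remove[of UNIV \<kappa>])
      then show "(\<Sum>m\<in>UNIV. p m) = q"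
        using sum_b by (simp add: p_def sum.remove[of UNIV \<kappa> b])
      have "b ` (UNIV - {\<kappa>}) = set (a i) - {b \<kappa>}"
        using b by (auto simp: bij_betw_def inj_on_def)
      then have img: "b ` (UNIV - {\<kappa>}) = set (del_coord (a i) (k i))"
        using k_range[OF i] length_a[OF i] b\<kappa> by (simp add: set_del_coord distinct_a[OF i])
      have "distinct (del_coord (a i) (k i))"
        unfolding del_coord_def using distinct_a[OF i]
        by (auto dest: in_set_takeD in_set_dropD simp: set_take_disj_set_drop_if_distinct)
      then have "mset (del_coord (a i) (k i)) = mset_set (b ` (UNIV - {\<kappa>}))"
        unfolding img by (rule mset_set_set[symmetric])
      also have "\<dots> = image_mset b (mset_set (UNIV - {\<kappa>}))"
        using b by (intro image_mset_mset_set[symmetric]) (auto simp: bij_betw_def inj_on_def)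
      also have "\<dots> = image_mset p (mset_set (UNIV - {\<kappa>}))"
        by (intro image_mset_cong) (auto simp: p_def)
      finally have "mset (del_coord (a i) (k i)) = image_mset p (mset_set (UNIV - {\<kappa>}))" .
      moreover have "mset_set (UNIV :: 'n set) = add_mset \<kappa> (mset_set (UNIV - {\<kappa>}))"
        by (rule mset_set.remove) auto
      ultimately show "mset (sort (del_coord (a i) (k i) @ [coord (a i) (k i) + q - switch a i]))
          = image_mset p (mset_set UNIV)"
        using b\<kappa> by (simp add: p_def)
    qed simp_all
  qed
qed

text \<open>Consecutive switches differ by at least 1, so even for an infinite canvas only finitely
  many are at most \<open>q\<close>; the last of them starts the interval.\<close>

lemma switch_interval:
  assumes "switch a 0 \<le> q"
  obtains i where "enat i < s" "switch a i \<le> q" "enat (i + 1) < s \<longrightarrow> q < switch a (i + 1)"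
proof -
  define I where "I i \<longleftrightarrow> enat i < s \<and> switch a i \<le> q" for i
  note s = zero_less_s
  have lin: "switch a 0 + real i \<le> switch a i" if "enat i < s" for i
    using that
  proof (induction i)
    case (Suc i)
    then have "enat i < s" by (metis Suc_ile_eq order_less_imp_le)
    then show ?case using Suc.IH switch_Suc[OF Suc.prems] \<delta>_ge by simp
  qed simp
  have bound: "i \<le> nat \<lceil>q - switch a 0\<rceil>" if "I i" for i
    using lin[of i] that unfolding I_def by linarith
  have "I 0" using s assms by (simp add: I_def)
  have G: "I (Greatest I)" "\<And>i. I i \<Longrightarrow> i \<le> Greatest I"
    using GreatestI_nat[where P = I, OF \<open>I 0\<close>] Greatest_le_nat[where P = I] bound by metis+
  show thesis
  proof (rule that[of "Greatest I"])
    show "enat (Greatest I + 1) < s \<longrightarrow> q < switch a (Greatest I + 1)"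
      using G(2)[of "Greatest I + 1"] by (force simp: I_def)
  qed (use G(1) in \<open>auto simp: I_def\<close>)
qed

end

theorem theorem5p5:
  fixes \<delta> q0 :: real and P :: "real \<Rightarrow> real list"
  assumes "CARD('n::finite) \<ge> 2"
    and "\<delta> \<ge> 4 + (real CARD('n) + 3) * ln 2"
    and "rigid_system CARD('n) \<delta> q0 P"
  shows "\<exists>u :: real ^ 'n. norm u = 1 \<and>
           (SUP q\<in>{q0..}. ereal (dist_inf CARD('n) (P q) (log_minima u q)))
             \<le> ereal (real CARD('n) * ln (8 * exp 4 * real CARD('n)))"
proof -
  obtain s a k l where sys: "canvas CARD('n) \<delta> s a k l \<and> q0 = switch a 0 \<and>
      (\<forall>i q. enat i < s \<and> switch a i \<le> q \<and> (enat (i + 1) < s \<longrightarrow> q < switch a (i + 1)) \<longrightarrow>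
         P q = sort (del_coord (a i) (k i) @ [coord (a i) (k i) + q - switch a i]))"
    using assms(3) unfolding rigid_system_def by (elim exE) (rule that)
  then have canvas: "canvas CARD('n) \<delta> s a k l" and q0: "q0 = switch a 0" by simp_all
  have P: "P q = sort (del_coord (a i) (k i) @ [coord (a i) (k i) + q - switch a i])"
    if "enat i < s" "switch a i \<le> q" "enat (i + 1) < s \<longrightarrow> q < switch a (i + 1)" for i q
    by (rule conjunct2[OF conjunct2[OF sys], rule_format]) (intro conjI that)
  interpret mesh_canvas \<delta> s a k l "TYPE('n)"
    by unfold_locales (fact assms canvas)+
  obtain u :: "real ^ 'n" where u: "norm u = 1"
    "\<And>i q. enat i < s \<Longrightarrow> switch a i \<le> q \<Longrightarrow> (enat (i + 1) < s \<longrightarrow> q < switch a (i + 1)) \<Longrightarrow>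
      dist_inf CARD('n) (sort (del_coord (a i) (k i) @ [coord (a i) (k i) + q - switch a i]))
        (log_minima u q) \<le> real CARD('n) * (ln 34 + ln 2 / 2)"
    by (rule approximating_vector) (rule that)
  have "dist_inf CARD('n) (P q) (log_minima u q) \<le> real CARD('n) * ln (8 * exp 4 * real CARD('n))"
    if q: "q0 \<le> q" for q
  proof -
    obtain i where i: "enat i < s" "switch a i \<le> q" "enat (i + 1) < s \<longrightarrow> q < switch a (i + 1)"
      using q unfolding q0 by (rule switch_interval)
    show ?thesis using u(2)[OF i] ln_bound unfolding P[OF i] by (rule order_trans)
  qed
  then show ?thesis using u(1) by (intro exI[of _ u] conjI SUP_least) auto
qed

end
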